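(* Let $n\ge 3$ and let $\gamma_1,\gamma_2$ be smooth functions on an open interval $I$. If $$\dot\gamma_1\gamma_1(\ddot\gamma_2\dot\gamma_1-\ddot\gamma_1\dot\gamma_2)>0$$ on $I$, then $F:I\times U\to\mathbb{A}^{n+1}$ ($U\subset\mathbb{R}^{n-1}$ open), $$F(t,\vec u)=\left(\gamma_1(t)\vec u,\ \gamma_1(t)\frac{\|\vec u\|^2}{2}+\gamma_2(t),\ \gamma_1(t)\right),$$ is a convex affine hypersurface with a pointwise $SO(n-1)$ symmetry. Its affine normal is $$\xi=\mu\,e_n+\nu\,\partial_t,\qquad \partial_t=\frac{\partial F}{\partial t},$$ where $e_n$ is the $n$-th standard basis vector of $\mathbb{R}^{n+1}$ and $\mu,\nu$ are functions of $t$ determined, for an appropriate choice of sign, by $$\dot\mu=-\nu\,\frac{\ddot\gamma_2\dot\gamma_1-\ddot\gamma_1\dot\gamma_2}{\dot\gamma_1},\qquad \mu^{n+2}\dot\gamma_1^3\gamma_1^{n-1}=\pm\left(\ddot\gamma_2\dot\gamma_1-\ddot\gamma_1\dot\gamma_2\right).$$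
   Context: $\mathbb{A}^{n+1}$ is $\mathbb{R}^{n+1}$ with its flat connection $D$ and the determinant as volume form. For an immersed hypersurface with transversal vector field $\xi$ write $D_XY=\nabla_XY+h(X,Y)\xi$, $D_X\xi=-SX+\tau(X)\xi$, and $\omega(X_1,\dots,X_n)=\det(X_1,\dots,X_n,\xi)$. If $h$ is non-degenerate, the affine normal is the transversal field $\xi$, unique up to sign, with $\nabla\omega=0$ (equivalently $\tau=0$) and $\omega(X_1,\dots,X_n)^2=|\det(h(X_i,X_j))|$ for tangent frames. The hypersurface is convex (strictly locally convex) when $h$ is definite, and the sign of $\xi$ is then chosen so that $h$ is positive definite. With this $\xi$, $h$ is the affine metric, $S$ the shape operator, $\nabla$ the Blaschke connection, $\hat\nabla$ the Levi-Civita connection of $h$, and $K(X,Y)=\nabla_XY-\hat\nabla_XY$ the difference tensor. Pointwise $SO(n-1)$ symmetry: at every point $p$ there is an $h$-unit tangent vector $X_1$ such that every linear automorphism $g$ of the tangent space at $p$ with $gX_1=X_1$ which restricts to an element of $SO(\langle X_1\rangle^\perp)$ satisfies $S(gX)=gS(X)$ and $K(gX,gY)=gK(X,Y)$ for all tangent $X,Y$. Dots denote derivatives with respect to $t$. *)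

theory Defs
  imports "HOL-Analysis.Analysis"
begin

section \<open>Smooth maps on open sets\<close>

abbreviation pushforward ::
  "('p::real_normed_vector \<Rightarrow> 'q::real_normed_vector) \<Rightarrow> 'p \<Rightarrow> 'p \<Rightarrow> 'q" where
  "pushforward f p \<equiv> frechet_derivative f (at p)"

fun times_differentiable_on ::
  "nat \<Rightarrow> 'p::real_normed_vector set \<Rightarrow> ('p \<Rightarrow> 'q::real_normed_vector) \<Rightarrow> bool" where
  "times_differentiable_on 0 \<Omega> f \<longleftrightarrow> continuous_on \<Omega> f"
| "times_differentiable_on (Suc k) \<Omega> f \<longleftrightarrow>
     (\<forall>p\<in>\<Omega>. f differentiable (at p)) \<and>
     (\<forall>v. times_differentiable_on k \<Omega> (\<lambda>p. pushforward f p v))"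

definition smooth_on ::
  "'p::real_normed_vector set \<Rightarrow> ('p \<Rightarrow> 'q::real_normed_vector) \<Rightarrow> bool" where
  "smooth_on \<Omega> f \<longleftrightarrow> (\<forall>k. times_differentiable_on k \<Omega> f)"


section \<open>Immersed hypersurfaces with a transversal field\<close>

text \<open>
  A hypersurface is given by a map \<open>F\<close> on an open set \<open>\<Omega>\<close> of a Euclidean space \<open>'p\<close> whose dimension
  \<open>n\<close> is the cardinality of the index type \<open>'n\<close>; the ambient space is \<open>real ^ 'n option\<close>.
  A vector \<open>v :: 'p\<close> stands for the tangent vector \<open>pushforward F p v\<close> at \<open>p\<close>, and a function
  \<open>Y :: 'p \<Rightarrow> 'p\<close> for the vector field with these values. Constant functions extend a single tangent
  vector to a vector field and are used to evaluate tensors.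
\<close>

definition immersed_hypersurface ::
  "'p::euclidean_space set \<Rightarrow> ('p \<Rightarrow> real ^ 'n::finite option) \<Rightarrow> bool" where
  "immersed_hypersurface \<Omega> F \<longleftrightarrow>
     DIM('p) = CARD('n) \<and> open \<Omega> \<and> smooth_on \<Omega> F \<and> (\<forall>p\<in>\<Omega>. inj (pushforward F p))"

definition transversal_field ::
  "'p::euclidean_space set \<Rightarrow> ('p \<Rightarrow> real ^ 'n::finite option) \<Rightarrow> ('p \<Rightarrow> real ^ 'n option) \<Rightarrow> bool" where
  "transversal_field \<Omega> F \<xi> \<longleftrightarrow> smooth_on \<Omega> \<xi> \<and> (\<forall>p\<in>\<Omega>. \<xi> p \<notin> range (pushforward F p))"

definition tangential_part ::
  "('p::euclidean_space \<Rightarrow> real ^ 'n::finite option) \<Rightarrow> ('p \<Rightarrow> real ^ 'n option) \<Rightarrow> 'p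
     \<Rightarrow> real ^ 'n option \<Rightarrow> 'p" where
  "tangential_part F \<xi> p z = (THE v. \<exists>a. z = pushforward F p v + a *\<^sub>R \<xi> p)"

definition transversal_part ::
  "('p::euclidean_space \<Rightarrow> real ^ 'n::finite option) \<Rightarrow> ('p \<Rightarrow> real ^ 'n option) \<Rightarrow> 'p
     \<Rightarrow> real ^ 'n option \<Rightarrow> real" where
  "transversal_part F \<xi> p z = (THE a. \<exists>v. z = pushforward F p v + a *\<^sub>R \<xi> p)"

text \<open>
  The tangential and transversal parts of \<open>D\<^sub>v Y\<close> and the negative tangential part of \<open>D\<^sub>v \<xi>\<close>, where
  \<open>v\<close> is a tangent vector at \<open>p\<close>.
\<close>

definition induced_connection ::
  "('p::euclidean_space \<Rightarrow> real ^ 'n::finite option) \<Rightarrow> ('p \<Rightarrow> real ^ 'n option) \<Rightarrow> 'p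
     \<Rightarrow> 'p \<Rightarrow> ('p \<Rightarrow> 'p) \<Rightarrow> 'p" where
  "induced_connection F \<xi> p v Y =
     tangential_part F \<xi> p (frechet_derivative (\<lambda>q. pushforward F q (Y q)) (at p) v)"

definition affine_form ::
  "('p::euclidean_space \<Rightarrow> real ^ 'n::finite option) \<Rightarrow> ('p \<Rightarrow> real ^ 'n option) \<Rightarrow> 'p
     \<Rightarrow> 'p \<Rightarrow> 'p \<Rightarrow> real" where
  "affine_form F \<xi> p v w =
     transversal_part F \<xi> p (frechet_derivative (\<lambda>q. pushforward F q w) (at p) v)"

definition shape_operator ::
  "('p::euclidean_space \<Rightarrow> real ^ 'n::finite option) \<Rightarrow> ('p \<Rightarrow> real ^ 'n option) \<Rightarrow> 'p
     \<Rightarrow> 'p \<Rightarrow> 'p" where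
  "shape_operator F \<xi> p v = - tangential_part F \<xi> p (frechet_derivative \<xi> (at p) v)"

definition induced_volume ::
  "('p::euclidean_space \<Rightarrow> real ^ 'n::finite option) \<Rightarrow> ('p \<Rightarrow> real ^ 'n option) \<Rightarrow> 'p
     \<Rightarrow> ('n \<Rightarrow> 'p) \<Rightarrow> real" where
  "induced_volume F \<xi> p X =
     det (\<chi> k. case k of None \<Rightarrow> \<xi> p | Some i \<Rightarrow> pushforward F p (X i))"

text \<open>The left-hand side is \<open>(\<nabla>\<^sub>v \<omega>)(X\<^sub>1, \<dots>, X\<^sub>n)\<close> at \<open>p\<close>, for \<open>\<omega> = induced_volume F \<xi>\<close>.\<close>

definition parallel_volume ::
  "'p::euclidean_space set \<Rightarrow> ('p \<Rightarrow> real ^ 'n::finite option) \<Rightarrow> ('p \<Rightarrow> real ^ 'n option) \<Rightarrow> bool" where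
  "parallel_volume \<Omega> F \<xi> \<longleftrightarrow>
     (\<forall>X :: 'n \<Rightarrow> 'p \<Rightarrow> 'p. (\<forall>i. smooth_on \<Omega> (X i)) \<longrightarrow>
       (\<forall>p\<in>\<Omega>. \<forall>v.
          frechet_derivative (\<lambda>q. induced_volume F \<xi> q (\<lambda>i. X i q)) (at p) v
          - (\<Sum>j\<in>UNIV. induced_volume F \<xi> p ((\<lambda>i. X i p)(j := induced_connection F \<xi> p v (X j))))
          = 0))"

definition nondegenerate :: "('p::real_vector \<Rightarrow> 'p \<Rightarrow> real) \<Rightarrow> bool" where
  "nondegenerate h \<longleftrightarrow> (\<forall>v. (\<forall>w. h v w = 0) \<longrightarrow> v = 0)"

definition positive_definite :: "('p::real_vector \<Rightarrow> 'p \<Rightarrow> real) \<Rightarrow> bool" where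
  "positive_definite h \<longleftrightarrow> (\<forall>v. v \<noteq> 0 \<longrightarrow> h v v > 0)"

definition definite :: "('p::real_vector \<Rightarrow> 'p \<Rightarrow> real) \<Rightarrow> bool" where
  "definite h \<longleftrightarrow> positive_definite h \<or> positive_definite (\<lambda>v w. - h v w)"

text \<open>Definiteness of \<open>h\<close> does not depend on the choice of the transversal field.\<close>

definition convex_hypersurface ::
  "'p::euclidean_space set \<Rightarrow> ('p \<Rightarrow> real ^ 'n::finite option) \<Rightarrow> bool" where
  "convex_hypersurface \<Omega> F \<longleftrightarrow>
     immersed_hypersurface \<Omega> F \<and>
     (\<exists>\<xi>. transversal_field \<Omega> F \<xi> \<and> (\<forall>p\<in>\<Omega>. definite (affine_form F \<xi> p)))"

definition affine_normal ::
  "'p::euclidean_space set \<Rightarrow> ('p \<Rightarrow> real ^ 'n::finite option) \<Rightarrow> ('p \<Rightarrow> real ^ 'n option) \<Rightarrow> bool" where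
  "affine_normal \<Omega> F \<xi> \<longleftrightarrow>
     transversal_field \<Omega> F \<xi> \<and>
     (\<forall>p\<in>\<Omega>. nondegenerate (affine_form F \<xi> p)) \<and>
     parallel_volume \<Omega> F \<xi> \<and>
     (\<forall>p\<in>\<Omega>. \<forall>X :: 'n \<Rightarrow> 'p. inj X \<and> independent (range X) \<longrightarrow>
        (induced_volume F \<xi> p X)\<^sup>2 = \<bar>det (\<chi> i j. affine_form F \<xi> p (X i) (X j))\<bar>)"

definition convex_affine_normal ::
  "'p::euclidean_space set \<Rightarrow> ('p \<Rightarrow> real ^ 'n::finite option) \<Rightarrow> ('p \<Rightarrow> real ^ 'n option) \<Rightarrow> bool" where
  "convex_affine_normal \<Omega> F \<xi> \<longleftrightarrow>
     affine_normal \<Omega> F \<xi> \<and> (\<forall>p\<in>\<Omega>. positive_definite (affine_form F \<xi> p))"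


section \<open>Levi-Civita connection and difference tensor\<close>

text \<open>\<open>C p v Y\<close> is the covariant derivative of the field \<open>Y\<close> along the tangent vector \<open>v\<close> at \<open>p\<close>.\<close>

definition affine_connection ::
  "'p::euclidean_space set \<Rightarrow> ('p \<Rightarrow> 'p \<Rightarrow> ('p \<Rightarrow> 'p) \<Rightarrow> 'p) \<Rightarrow> bool" where
  "affine_connection \<Omega> C \<longleftrightarrow>
     (\<forall>X Y. smooth_on \<Omega> X \<and> smooth_on \<Omega> Y \<longrightarrow> smooth_on \<Omega> (\<lambda>p. C p (X p) Y)) \<and>
     (\<forall>Y. smooth_on \<Omega> Y \<longrightarrow> (\<forall>p\<in>\<Omega>. linear (\<lambda>v. C p v Y))) \<and>
     (\<forall>Y Z. smooth_on \<Omega> Y \<and> smooth_on \<Omega> Z \<longrightarrow>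
        (\<forall>p\<in>\<Omega>. \<forall>v. C p v (\<lambda>q. Y q + Z q) = C p v Y + C p v Z)) \<and>
     (\<forall>f Y. smooth_on \<Omega> f \<and> smooth_on \<Omega> Y \<longrightarrow>
        (\<forall>p\<in>\<Omega>. \<forall>v. C p v (\<lambda>q. f q *\<^sub>R Y q)
           = frechet_derivative f (at p) v *\<^sub>R Y p + f p *\<^sub>R C p v Y))"

definition lie_bracket ::
  "('p::euclidean_space \<Rightarrow> 'p) \<Rightarrow> ('p \<Rightarrow> 'p) \<Rightarrow> 'p \<Rightarrow> 'p" where
  "lie_bracket X Y p = frechet_derivative Y (at p) (X p) - frechet_derivative X (at p) (Y p)"

definition is_levi_civita ::
  "'p::euclidean_space set \<Rightarrow> ('p \<Rightarrow> 'p \<Rightarrow> 'p \<Rightarrow> real)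
     \<Rightarrow> ('p \<Rightarrow> 'p \<Rightarrow> ('p \<Rightarrow> 'p) \<Rightarrow> 'p) \<Rightarrow> bool" where
  "is_levi_civita \<Omega> h C \<longleftrightarrow>
     affine_connection \<Omega> C \<and>
     (\<forall>X Y. smooth_on \<Omega> X \<and> smooth_on \<Omega> Y \<longrightarrow>
        (\<forall>p\<in>\<Omega>. C p (X p) Y - C p (Y p) X = lie_bracket X Y p)) \<and>
     (\<forall>Y Z. smooth_on \<Omega> Y \<and> smooth_on \<Omega> Z \<longrightarrow>
        (\<forall>p\<in>\<Omega>. \<forall>v. frechet_derivative (\<lambda>q. h q (Y q) (Z q)) (at p) v
           = h p (C p v Y) (Z p) + h p (Y p) (C p v Z)))"

text \<open>On smooth fields and at points of \<open>\<Omega>\<close> the connection is unique, so the choice is immaterial.\<close>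

definition levi_civita ::
  "'p::euclidean_space set \<Rightarrow> ('p \<Rightarrow> 'p \<Rightarrow> 'p \<Rightarrow> real) \<Rightarrow> 'p \<Rightarrow> 'p \<Rightarrow> ('p \<Rightarrow> 'p) \<Rightarrow> 'p" where
  "levi_civita \<Omega> h = (SOME C. is_levi_civita \<Omega> h C)"

definition difference_tensor ::
  "'p::euclidean_space set \<Rightarrow> ('p \<Rightarrow> real ^ 'n::finite option) \<Rightarrow> ('p \<Rightarrow> real ^ 'n option) \<Rightarrow> 'p
     \<Rightarrow> 'p \<Rightarrow> 'p \<Rightarrow> 'p" where
  "difference_tensor \<Omega> F \<xi> p v w =
     induced_connection F \<xi> p v (\<lambda>_. w) - levi_civita \<Omega> (affine_form F \<xi>) p v (\<lambda>_. w)"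


section \<open>Pointwise symmetry\<close>

text \<open>
  The determinant of an endomorphism \<open>g\<close> of the subspace \<open>V\<close>, by the Leibniz formula for the matrix
  of \<open>g\<close> in some basis of \<open>V\<close>.
\<close>

definition det_on :: "'p::euclidean_space set \<Rightarrow> ('p \<Rightarrow> 'p) \<Rightarrow> real" where
  "det_on V g =
     (let B = (SOME B. independent B \<and> span B = V)
      in \<Sum>\<pi> | \<pi> permutes B. of_int (sign \<pi>) * (\<Prod>b\<in>B. representation B (g b) (\<pi> b)))"

definition restricts_to_SO ::
  "('p::euclidean_space \<Rightarrow> 'p \<Rightarrow> real) \<Rightarrow> 'p set \<Rightarrow> ('p \<Rightarrow> 'p) \<Rightarrow> bool" where
  "restricts_to_SO h V g \<longleftrightarrow>
     g ` V \<subseteq> V \<and> (\<forall>x\<in>V. \<forall>y\<in>V. h (g x) (g y) = h x y) \<and> det_on V g = 1"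

definition pointwise_SO_symmetry ::
  "'p::euclidean_space set \<Rightarrow> ('p \<Rightarrow> real ^ 'n::finite option) \<Rightarrow> bool" where
  "pointwise_SO_symmetry \<Omega> F \<longleftrightarrow>
     (\<exists>\<xi>. convex_affine_normal \<Omega> F \<xi> \<and>
       (\<forall>p\<in>\<Omega>. \<exists>X1. affine_form F \<xi> p X1 X1 = 1 \<and>
         (\<forall>g. linear g \<and> bij g \<and> g X1 = X1 \<and>
              restricts_to_SO (affine_form F \<xi> p) {x. affine_form F \<xi> p X1 x = 0} g \<longrightarrow>
            (\<forall>x. shape_operator F \<xi> p (g x) = g (shape_operator F \<xi> p x)) \<and>
            (\<forall>x y. difference_tensor \<Omega> F \<xi> p (g x) (g y) = g (difference_tensor \<Omega> F \<xi> p x y)))))"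


section \<open>The hypersurface generated by a curve\<close>

text \<open>
  For \<open>CARD('m) = n - 1\<close> the indices \<open>Some (Some i)\<close> play the role of \<open>1, \<dots>, n - 1\<close>, while
  \<open>Some None\<close> is \<open>n\<close> and \<open>None\<close> is \<open>n + 1\<close>.
\<close>

definition coords :: "real ^ 'm::finite \<Rightarrow> real \<Rightarrow> real \<Rightarrow> real ^ 'm option option" where
  "coords x y z =
     (\<chi> k. case k of None \<Rightarrow> z | Some None \<Rightarrow> y | Some (Some i) \<Rightarrow> x $ i)"

definition e_n :: "real ^ 'm::finite option option" where
  "e_n = axis (Some None) 1"

definition curve_hypersurface ::
  "(real \<Rightarrow> real) \<Rightarrow> (real \<Rightarrow> real) \<Rightarrow> real \<times> (real ^ 'm::finite) \<Rightarrow> real ^ 'm option option" where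
  "curve_hypersurface \<gamma>1 \<gamma>2 =
     (\<lambda>(t, u). coords (\<gamma>1 t *\<^sub>R u) (\<gamma>1 t * ((norm u)\<^sup>2 / 2) + \<gamma>2 t) (\<gamma>1 t))"

definition curve_det :: "(real \<Rightarrow> real) \<Rightarrow> (real \<Rightarrow> real) \<Rightarrow> real \<Rightarrow> real" where
  "curve_det \<gamma>1 \<gamma>2 t = deriv (deriv \<gamma>2) t * deriv \<gamma>1 t - deriv (deriv \<gamma>1) t * deriv \<gamma>2 t"

text \<open>The parameter \<open>\<sigma>\<close> is the sign \<open>\<plusminus>\<close>.\<close>

definition normal_equations ::
  "nat \<Rightarrow> real set \<Rightarrow> (real \<Rightarrow> real) \<Rightarrow> (real \<Rightarrow> real) \<Rightarrow> real \<Rightarrow> (real \<Rightarrow> real) \<Rightarrow> (real \<Rightarrow> real) \<Rightarrow> bool"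
  where
  "normal_equations n I \<gamma>1 \<gamma>2 \<sigma> \<mu> \<nu> \<longleftrightarrow>
     \<mu> differentiable_on I \<and>
     (\<forall>t\<in>I. deriv \<mu> t = - \<nu> t * (curve_det \<gamma>1 \<gamma>2 t / deriv \<gamma>1 t) \<and>
            \<mu> t ^ (n + 2) * deriv \<gamma>1 t ^ 3 * \<gamma>1 t ^ (n - 1) = \<sigma> * curve_det \<gamma>1 \<gamma>2 t)"

end

theory Submission
  imports Defs
begin

text \<open>
  Let \<open>N\<close> be the conormal field with \<open>N \<bullet> F\<^sub>* v = 0\<close> and \<open>N \<bullet> e_n = 1\<close>. Then \<open>N \<bullet> D\<^sub>v (F\<^sub>* w)\<close> is the
  diagonal form \<open>k = (\<delta> / \<gamma>1') dt\<^sup>2 + \<gamma>1 |du|\<^sup>2\<close>, where \<open>\<delta> = curve_det \<gamma>1 \<gamma>2\<close>, and a transversal field \<open>\<xi>\<close>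
  induces the form \<open>k / (N \<bullet> \<xi>)\<close>. The volume condition determines \<open>|N \<bullet> \<xi>|\<close> and \<open>\<nabla>\<omega> = 0\<close> says \<open>N \<bullet> D\<xi> = 0\<close>.
  Two solutions differ by a tangent field \<open>F\<^sub>* Z\<close> with \<open>k(v, Z) = - D\<^sub>v N \<bullet> F\<^sub>* Z = 0\<close> for all \<open>v\<close>, hence
  coincide; the field \<open>\<mu> e_n + \<nu> \<partial>\<^sub>t\<close> is a solution. Its affine metric is a warped product
  metric over \<open>I\<close>, so its Levi-Civita connection is explicit, and the shape operator and the
  difference tensor are built from \<open>dt\<close> and the Euclidean inner product on the fibres only.
\<close>

section \<open>Smooth maps\<close>

text \<open>The vector \<open>e_n\<close> is constant, so it serves as a reference transversal
  field: \<open>F_tt\<close> differs from a multiple of \<open>F_t\<close> by a multiple of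
  \<open>e_n\<close>, the mixed derivatives are tangent, and the second derivatives in u are
  multiples of \<open>e_n\<close>. This is why the form is diagonal. The exponent n + 2 comes from
  degrees in a = \<open>N \<bullet> \<xi>\<close>: the square of the volume has degree 2, the
  determinant of the n by n matrix of k / a has degree -n. The equation for the derivative of
  \<open>\<mu>\<close> is never integrated: the power equation fixes \<open>\<mu>\<close> up to
  sign, and the other equation, which is the vanishing of the \<open>e_n\<close>-part of D\<xi>, is
  solved for \<open>\<nu>\<close>. On signs, the hypothesis makes k definite but possibly negative,
  so \<open>\<mu>\<close> must have the sign of \<open>\<gamma>1\<close>; continuity on the interval
  makes such choices uniform. On the metric side the obstacle is that the Levi-Civita connection is
  given as a choice satisfying axioms on smooth fields, so the explicit connection has to satisfy
  all of them, smoothness included, before a uniqueness argument can identify the two.\<close>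

lemma pushforward_eqI: "(f has_derivative f') (at p) \<Longrightarrow> pushforward f p = f'"
  using frechet_derivative_at by metis

lemma pushforward_cong:
  assumes "open \<Omega>" "p \<in> \<Omega>" "\<And>q. q \<in> \<Omega> \<Longrightarrow> f q = g q"
  shows "pushforward f p = pushforward g p"
proof -
  have "(f has_derivative f') (at p) \<longleftrightarrow> (g has_derivative f') (at p)" for f'
    using has_derivative_transform_within_open[OF _ assms(1,2), of f f' UNIV g]
      has_derivative_transform_within_open[OF _ assms(1,2), of g f' UNIV f] assms(3) by auto
  then show ?thesis
    by (simp add: frechet_derivative_def)
qed

lemma differentiable_cong_open:
  assumes "open \<Omega>" "p \<in> \<Omega>" "\<And>q. q \<in> \<Omega> \<Longrightarrow> f q = g q"
  shows "f differentiable (at p) \<longleftrightarrow> g differentiable (at p)"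
  using has_derivative_transform_within_open[OF _ assms(1,2), of f _ UNIV g]
    has_derivative_transform_within_open[OF _ assms(1,2), of g _ UNIV f] assms(3)
  unfolding differentiable_def by metis

text \<open>Derivatives at p depend only on a neighbourhood of p, so on an open set the values
  outside can be ignored at every order.\<close>

lemma times_differentiable_on_cong:
  assumes "open \<Omega>" "\<And>q. q \<in> \<Omega> \<Longrightarrow> f q = g q"
  shows "times_differentiable_on k \<Omega> f \<longleftrightarrow> times_differentiable_on k \<Omega> g"
  using assms(2)
proof (induction k arbitrary: f g)
  case 0
  then show ?case
    by (simp cong: continuous_on_cong)
next
  case (Suc k)
  have "times_differentiable_on k \<Omega> (\<lambda>p. pushforward f p v)
      \<longleftrightarrow> times_differentiable_on k \<Omega> (\<lambda>p. pushforward g p v)" for v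
    by (rule Suc.IH) (simp add: pushforward_cong[OF assms(1) _ Suc.prems])
  then show ?case
    using differentiable_cong_open[OF assms(1) _ Suc.prems] by auto
qed

lemma smooth_on_cong:
  assumes "open \<Omega>" "\<And>q. q \<in> \<Omega> \<Longrightarrow> f q = g q"
  shows "smooth_on \<Omega> f \<longleftrightarrow> smooth_on \<Omega> g"
  using times_differentiable_on_cong[OF assms] by (simp add: smooth_on_def)

lemma times_differentiable_on_SucD:
  "times_differentiable_on (Suc k) \<Omega> f \<Longrightarrow> times_differentiable_on k \<Omega> f"
proof (induction k arbitrary: f)
  case 0
  then show ?case
    by (simp add: differentiable_imp_continuous_within continuous_at_imp_continuous_on)
next
  case (Suc k)
  then show ?case
    by (metis times_differentiable_on.simps(2))
qed

lemma times_differentiable_on_has_derivative: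
  "times_differentiable_on (Suc k) \<Omega> f \<Longrightarrow> p \<in> \<Omega> \<Longrightarrow> (f has_derivative pushforward f p) (at p)"
  by (simp add: frechet_derivative_works[symmetric])

text \<open>\<open>frechet_derivative\<close> is a choice that agrees with a computed derivative
  \<open>d\<close> only on \<open>\<Omega>\<close>. This rule hides the difference, so the
  inductions below can supply \<open>d\<close> from the usual rules of differentiation.\<close>

lemma times_differentiable_on_SucI:
  assumes "open \<Omega>" "\<And>p. p \<in> \<Omega> \<Longrightarrow> (f has_derivative d p) (at p)"
    "\<And>v. times_differentiable_on k \<Omega> (\<lambda>p. d p v)"
  shows "times_differentiable_on (Suc k) \<Omega> f"
proof -
  have "times_differentiable_on k \<Omega> (\<lambda>p. pushforward f p v)" for v
    using assms(3) times_differentiable_on_cong[OF assms(1), of "\<lambda>p. pushforward f p v" "\<lambda>p. d p v"]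
    by (simp add: pushforward_eqI[OF assms(2)])
  then show ?thesis
    using assms(2) by (auto simp: differentiable_def)
qed

lemma smooth_on_has_derivative:
  "smooth_on \<Omega> f \<Longrightarrow> p \<in> \<Omega> \<Longrightarrow> (f has_derivative pushforward f p) (at p)"
  using times_differentiable_on_has_derivative unfolding smooth_on_def by blast

lemma smooth_on_pushforward: "smooth_on \<Omega> f \<Longrightarrow> smooth_on \<Omega> (\<lambda>p. pushforward f p v)"
  unfolding smooth_on_def
  by (metis times_differentiable_on.simps(2))

lemma times_differentiable_on_const: "times_differentiable_on k \<Omega> (\<lambda>p. c)"
  by (induction k arbitrary: c) auto

lemma times_differentiable_on_bounded_linear:
  assumes "bounded_linear L" "open \<Omega>" "times_differentiable_on k \<Omega> f"
  shows "times_differentiable_on k \<Omega> (\<lambda>p. L (f p))"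
  using assms(3)
proof (induction k arbitrary: f)
  case 0
  then show ?case
    using bounded_linear.continuous_on[OF assms(1)] by simp
next
  case (Suc k)
  show ?case
  proof (rule times_differentiable_on_SucI[OF assms(2)])
    show "((\<lambda>p. L (f p)) has_derivative (\<lambda>v. L (pushforward f p v))) (at p)" if "p \<in> \<Omega>" for p
      by (rule bounded_linear.has_derivative[OF assms(1)
            times_differentiable_on_has_derivative[OF Suc.prems that]])
  qed (use Suc in auto)
qed

lemma times_differentiable_on_add:
  assumes "open \<Omega>" "times_differentiable_on k \<Omega> f" "times_differentiable_on k \<Omega> g"
  shows "times_differentiable_on k \<Omega> (\<lambda>p. f p + g p)"
  using assms(2,3)
proof (induction k arbitrary: f g)
  case 0
  then show ?case
    by (simp add: continuous_on_add)
next
  case (Suc k)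
  show ?case
  proof (rule times_differentiable_on_SucI[OF assms(1)])
    show "((\<lambda>p. f p + g p) has_derivative (\<lambda>v. pushforward f p v + pushforward g p v)) (at p)"
      if "p \<in> \<Omega>" for p
      by (intro has_derivative_add times_differentiable_on_has_derivative[OF Suc.prems(1) that]
          times_differentiable_on_has_derivative[OF Suc.prems(2) that])
  qed (use Suc in auto)
qed

text \<open>One product rule for scalar multiplication, multiplication and inner products. Both
  terms of the derivative are again \<open>B\<close> of two k times differentiable maps, so the
  induction closes.\<close>

lemma times_differentiable_on_bilinear:
  assumes "bounded_bilinear B" "open \<Omega>" "times_differentiable_on k \<Omega> f" "times_differentiable_on k \<Omega> g"
  shows "times_differentiable_on k \<Omega> (\<lambda>p. B (f p) (g p))"
  using assms(3,4)
proof (induction k arbitrary: f g)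
  case 0
  then show ?case
    using bounded_bilinear.continuous_on[OF assms(1)] by simp
next
  case (Suc k)
  show ?case
  proof (rule times_differentiable_on_SucI[OF assms(2)])
    show "((\<lambda>p. B (f p) (g p)) has_derivative
        (\<lambda>v. B (f p) (pushforward g p v) + B (pushforward f p v) (g p))) (at p)" if "p \<in> \<Omega>" for p
      by (intro bounded_bilinear.FDERIV[OF assms(1)]
          times_differentiable_on_has_derivative[OF Suc.prems(1) that]
          times_differentiable_on_has_derivative[OF Suc.prems(2) that])
    show "times_differentiable_on k \<Omega> (\<lambda>p. B (f p) (pushforward g p v) + B (pushforward f p v) (g p))"
      for v
      using Suc.prems Suc.prems[THEN times_differentiable_on_SucD]
      by (intro times_differentiable_on_add assms(2) Suc.IH) simp_all
  qed
qed

lemma times_differentiable_on_sum: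
  assumes "open \<Omega>" "\<And>i. i \<in> A \<Longrightarrow> times_differentiable_on k \<Omega> (f i)"
  shows "times_differentiable_on k \<Omega> (\<lambda>p. \<Sum>i\<in>A. f i p)"
  using assms(2)
proof (induction A rule: infinite_finite_induct)
  case (insert x A)
  then have "times_differentiable_on k \<Omega> (\<lambda>p. f x p + (\<Sum>i\<in>A. f i p))"
    by (intro times_differentiable_on_add assms(1)) auto
  then show ?case
    using insert by simp
qed (auto simp: times_differentiable_on_const)

lemma linear_expand_Basis:
  fixes f :: "'a::euclidean_space \<Rightarrow> 'b::real_vector"
  assumes "linear f"
  shows "f x = (\<Sum>b\<in>Basis. (x \<bullet> b) *\<^sub>R f b)"
proof -
  have "f x = f (\<Sum>b\<in>Basis. (x \<bullet> b) *\<^sub>R b)"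
    by (simp add: euclidean_representation)
  then show ?thesis
    by (simp add: linear_sum[OF assms] linear_cmul[OF assms])
qed

lemma times_differentiable_on_compose:
  fixes f :: "'p::real_normed_vector \<Rightarrow> 'q::euclidean_space" and g :: "'q \<Rightarrow> 'r::real_normed_vector"
  assumes "open \<Omega>" "times_differentiable_on k \<Omega> f" "times_differentiable_on k T g" "f ` \<Omega> \<subseteq> T"
  shows "times_differentiable_on k \<Omega> (\<lambda>p. g (f p))"
  using assms(2,3)
proof (induction k arbitrary: g)
  case 0
  then show ?case
    using continuous_on_compose2 assms(4) by auto
next
  case (Suc k)
  \<comment> \<open>The chain rule evaluates the derivative of \<open>g\<close> in the direction
    \<open>pushforward f p v\<close>, which moves with p, while the induction hypothesis covers
    fixed directions only. Expanding in \<open>Basis\<close> leaves fixed directions with scalar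
    coefficients.\<close>
  let ?d = "\<lambda>p v. \<Sum>b\<in>Basis. (pushforward f p v \<bullet> b) *\<^sub>R pushforward g (f p) b"
  show ?case
  proof (rule times_differentiable_on_SucI[OF assms(1)])
    show "((\<lambda>p. g (f p)) has_derivative ?d p) (at p)" if "p \<in> \<Omega>" for p
    proof -
      have f: "(f has_derivative pushforward f p) (at p)"
        using times_differentiable_on_has_derivative[OF Suc.prems(1) that] .
      have "f p \<in> T"
        using that assms(4) by auto
      then have g: "(g has_derivative pushforward g (f p)) (at (f p))"
        using times_differentiable_on_has_derivative[OF Suc.prems(2)] by blast
      have "?d p = (\<lambda>v. pushforward g (f p) (pushforward f p v))"
        using linear_expand_Basis[OF has_derivative_linear[OF g], symmetric] by (intro ext)
      then show ?thesis
        using has_derivative_compose[OF f g] by simp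
    qed
    show "times_differentiable_on k \<Omega> (\<lambda>p. ?d p v)" for v
    proof (intro times_differentiable_on_sum[OF assms(1)]
        times_differentiable_on_bilinear[OF bounded_bilinear_scaleR assms(1)]
        times_differentiable_on_bounded_linear[OF bounded_linear_inner_left assms(1)])
      fix b :: 'q
      show "times_differentiable_on k \<Omega> (\<lambda>p. pushforward f p v)"
        using Suc.prems(1) by simp
      show "times_differentiable_on k \<Omega> (\<lambda>p. pushforward g (f p) b)"
        using Suc.prems(2) times_differentiable_on_SucD[OF Suc.prems(1)] by (intro Suc.IH) auto
    qed
  qed
qed

lemma smooth_on_const: "smooth_on \<Omega> (\<lambda>p. c)"
  by (simp add: smooth_on_def times_differentiable_on_const)

lemma smooth_on_bounded_linear:
  "bounded_linear L \<Longrightarrow> open \<Omega> \<Longrightarrow> smooth_on \<Omega> f \<Longrightarrow> smooth_on \<Omega> (\<lambda>p. L (f p))"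
  by (simp add: smooth_on_def times_differentiable_on_bounded_linear)

lemma times_differentiable_on_ident: "open \<Omega> \<Longrightarrow> times_differentiable_on k \<Omega> (\<lambda>p. p)"
proof (cases k)
  case (Suc l)
  assume "open \<Omega>"
  then show ?thesis
    using times_differentiable_on_SucI[OF _ has_derivative_ident times_differentiable_on_const] Suc
    by blast
qed simp

lemma smooth_on_ident: "open \<Omega> \<Longrightarrow> smooth_on \<Omega> (\<lambda>p. p)"
  by (simp add: smooth_on_def times_differentiable_on_ident)

lemma smooth_on_linear: "bounded_linear L \<Longrightarrow> open \<Omega> \<Longrightarrow> smooth_on \<Omega> L"
  using smooth_on_bounded_linear[OF _ _ smooth_on_ident] by blast

lemma smooth_on_add:
  "open \<Omega> \<Longrightarrow> smooth_on \<Omega> f \<Longrightarrow> smooth_on \<Omega> g \<Longrightarrow> smooth_on \<Omega> (\<lambda>p. f p + g p)"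
  by (simp add: smooth_on_def times_differentiable_on_add)

lemma smooth_on_bilinear:
  "bounded_bilinear B \<Longrightarrow> open \<Omega> \<Longrightarrow> smooth_on \<Omega> f \<Longrightarrow> smooth_on \<Omega> g \<Longrightarrow> smooth_on \<Omega> (\<lambda>p. B (f p) (g p))"
  by (simp add: smooth_on_def times_differentiable_on_bilinear)

lemmas smooth_on_scaleR = smooth_on_bilinear[OF bounded_bilinear_scaleR]
lemmas smooth_on_mult = smooth_on_bilinear[OF bounded_bilinear_mult]
lemmas smooth_on_inner = smooth_on_bilinear[OF bounded_bilinear_inner]

lemma smooth_on_sum:
  "open \<Omega> \<Longrightarrow> (\<And>i. i \<in> A \<Longrightarrow> smooth_on \<Omega> (f i)) \<Longrightarrow> smooth_on \<Omega> (\<lambda>p. \<Sum>i\<in>A. f i p)"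
  by (simp add: smooth_on_def times_differentiable_on_sum)

lemma smooth_on_compose:
  fixes f :: "'p::real_normed_vector \<Rightarrow> 'q::euclidean_space" and g :: "'q \<Rightarrow> 'r::real_normed_vector"
  assumes "open \<Omega>" "smooth_on \<Omega> f" "smooth_on T g" "f ` \<Omega> \<subseteq> T"
  shows "smooth_on \<Omega> (\<lambda>p. g (f p))"
  using assms times_differentiable_on_compose unfolding smooth_on_def by blast

lemma smooth_on_minus: "open \<Omega> \<Longrightarrow> smooth_on \<Omega> f \<Longrightarrow> smooth_on \<Omega> (\<lambda>p. - f p)"
  using smooth_on_bounded_linear[OF bounded_linear_minus[OF bounded_linear_ident]] .

lemma smooth_on_diff:
  "open \<Omega> \<Longrightarrow> smooth_on \<Omega> f \<Longrightarrow> smooth_on \<Omega> g \<Longrightarrow> smooth_on \<Omega> (\<lambda>p. f p - g p)"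
  using smooth_on_add[OF _ _ smooth_on_minus, of \<Omega> f g] by simp

lemma smooth_on_inverse_real: "smooth_on (- {0}) (inverse :: real \<Rightarrow> real)"
proof -
  have "times_differentiable_on k (- {0}) (inverse :: real \<Rightarrow> real)" for k
  proof (induction k)
    case 0
    then show ?case
      by (auto intro: continuous_intros)
  next
    case (Suc k)
    show ?case
    proof (rule times_differentiable_on_SucI)
      show "(inverse has_derivative (\<lambda>v. (- v) * (inverse x * inverse x))) (at x)"
        if "x \<in> - {0}" for x :: real
        using has_derivative_inverse'[of x] that by (simp add: mult.commute mult.left_commute)
      show "times_differentiable_on k (- {0}) (\<lambda>x. (- v) * (inverse x * inverse x))" for v :: real
        using Suc by (intro times_differentiable_on_bilinear[OF bounded_bilinear_mult]
            times_differentiable_on_const) auto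
    qed auto
  qed
  then show ?thesis
    by (simp add: smooth_on_def)
qed

text \<open>The induction runs over all exponents because differentiation lowers the exponent by
  one. The lemma serves the (n+2)-nd root in \<open>\<mu>\<close>.\<close>

lemma smooth_on_powr_real: "smooth_on {0<..} (\<lambda>x::real. x powr a)"
proof -
  have "times_differentiable_on k {0<..} (\<lambda>x::real. x powr a)" for k
  proof (induction k arbitrary: a)
    case 0
    then show ?case
      by (auto intro!: continuous_intros)
  next
    case (Suc k)
    show ?case
    proof (rule times_differentiable_on_SucI)
      show "((\<lambda>x. x powr a) has_derivative (\<lambda>v. (a * v) * x powr (a - 1))) (at x)"
        if "x \<in> {0<..}" for x :: real
        using has_real_derivative_powr[of x a] that
        by (auto simp: has_field_derivative_def elim!: has_derivative_eq_rhs)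
      show "times_differentiable_on k {0<..} (\<lambda>x. (a * v) * x powr (a - 1))" for v :: real
        using Suc by (intro times_differentiable_on_bilinear[OF bounded_bilinear_mult]
            times_differentiable_on_const) auto
    qed auto
  qed
  then show ?thesis
    by (simp add: smooth_on_def)
qed

lemma smooth_on_inverse:
  fixes f :: "'p::real_normed_vector \<Rightarrow> real"
  assumes "open \<Omega>" "smooth_on \<Omega> f" "\<And>p. p \<in> \<Omega> \<Longrightarrow> f p \<noteq> 0"
  shows "smooth_on \<Omega> (\<lambda>p. inverse (f p))"
  using assms by (intro smooth_on_compose[OF _ _ smooth_on_inverse_real]) auto

lemma smooth_on_divide:
  fixes f :: "'p::real_normed_vector \<Rightarrow> real"
  assumes "open \<Omega>" "smooth_on \<Omega> f" "smooth_on \<Omega> g" "\<And>p. p \<in> \<Omega> \<Longrightarrow> g p \<noteq> 0"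
  shows "smooth_on \<Omega> (\<lambda>p. f p / g p)"
  using assms by (simp add: divide_inverse smooth_on_mult smooth_on_inverse)

lemma smooth_on_powr:
  fixes f :: "'p::real_normed_vector \<Rightarrow> real"
  assumes "open \<Omega>" "smooth_on \<Omega> f" "\<And>p. p \<in> \<Omega> \<Longrightarrow> f p > 0"
  shows "smooth_on \<Omega> (\<lambda>p. f p powr a)"
  using assms by (intro smooth_on_compose[OF _ _ smooth_on_powr_real]) auto

lemma smooth_on_power:
  fixes f :: "'p::real_normed_vector \<Rightarrow> real"
  assumes "open \<Omega>" "smooth_on \<Omega> f"
  shows "smooth_on \<Omega> (\<lambda>p. f p ^ k)"
  using assms by (induction k) (auto simp: smooth_on_const smooth_on_mult)

lemma smooth_on_real_has_derivative:
  assumes "smooth_on I \<gamma>" "t \<in> I"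
  shows "(\<gamma> has_real_derivative deriv \<gamma> t) (at t)"
  using smooth_on_has_derivative[OF assms]
  by (metis DERIV_deriv_iff_real_differentiable differentiable_def)

lemma smooth_on_deriv:
  fixes \<gamma> :: "real \<Rightarrow> real"
  assumes "open I" "smooth_on I \<gamma>"
  shows "smooth_on I (deriv \<gamma>)"
proof (subst smooth_on_cong[OF assms(1)])
  show "deriv \<gamma> t = pushforward \<gamma> t 1" if "t \<in> I" for t
    using pushforward_eqI[OF smooth_on_real_has_derivative[OF assms(2) that, unfolded has_field_derivative_def]]
    by simp
qed (rule smooth_on_pushforward[OF assms(2)])

text \<open>Expansion in \<open>Basis\<close> reduces a direction that varies with p to the fixed
  directions of \<open>smooth_on_pushforward\<close>.\<close>

lemma smooth_on_pushforward_field: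
  fixes f :: "'p::euclidean_space \<Rightarrow> 'q::real_normed_vector"
  assumes "open \<Omega>" "smooth_on \<Omega> f" "smooth_on \<Omega> X"
  shows "smooth_on \<Omega> (\<lambda>p. pushforward f p (X p))"
proof (subst smooth_on_cong[OF assms(1)])
  show "pushforward f p (X p) = (\<Sum>b\<in>Basis. (X p \<bullet> b) *\<^sub>R pushforward f p b)" if "p \<in> \<Omega>" for p
    using linear_expand_Basis[OF has_derivative_linear[OF smooth_on_has_derivative[OF assms(2) that]]] .
qed (intro smooth_on_sum smooth_on_scaleR smooth_on_inner smooth_on_const smooth_on_pushforward assms)

section \<open>Determinants\<close>

text \<open>Laplace expansion along row \<open>None\<close>: in the Leibniz sum only the
  permutations that fix \<open>None\<close> survive, and they correspond to the permutations of
  \<open>'n\<close>.\<close>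

lemma det_option:
  fixes A :: "real ^ ('n::finite option) ^ ('n option)"
  assumes "\<And>j. A $ None $ Some j = 0"
  shows "det A = A $ None $ None * det (\<chi> i j. A $ Some i $ Some j)"
proof -
  let ?R = "range (Some :: 'n \<Rightarrow> 'n option)"
  let ?f = "\<lambda>p. of_int (sign p) * (\<Prod>i\<in>UNIV. A $ i $ p i)"
  have U: "(UNIV :: 'n option set) = insert None ?R"
    by (rule UNIV_option_conv)
  have "det A = (\<Sum>p | p permutes insert None ?R. ?f p)"
    by (simp add: det_def U[symmetric])
  \<comment> \<open>Every permutation is uniquely a transposition of \<open>None\<close> with some b
    after a permutation q of \<open>range Some\<close>. As q fixes \<open>None\<close>, for b =
    \<open>Some j\<close> the product contains the zero entry in column \<open>Some j\<close> of row
    \<open>None\<close>.\<close>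
  also have "\<dots> = (\<Sum>b\<in>insert None ?R. \<Sum>q | q permutes ?R. ?f (Transposition.transpose None b \<circ> q))"
    by (rule sum_over_permutations_insert) auto
  also have "\<dots> = (\<Sum>b\<in>{None}. \<Sum>q | q permutes ?R. ?f (Transposition.transpose None b \<circ> q))"
  proof (rule sum.mono_neutral_right)
    show "\<forall>b\<in>insert None ?R - {None}. (\<Sum>q | q permutes ?R. ?f (Transposition.transpose None b \<circ> q)) = 0"
    proof
      fix b assume "b \<in> insert None ?R - {None}"
      then obtain j where b: "b = Some j" by auto
      show "(\<Sum>q | q permutes ?R. ?f (Transposition.transpose None b \<circ> q)) = 0"
      proof (rule sum.neutral, safe)
        fix q assume "q permutes ?R"
        then have "q None = None"
          by (auto simp: permutes_def)
        then have "A $ None $ (Transposition.transpose None b \<circ> q) None = 0"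
          using assms b by simp
        then have "(\<Prod>i\<in>UNIV. A $ i $ (Transposition.transpose None b \<circ> q) i) = 0"
          by (intro prod_zero) auto
        then show "?f (Transposition.transpose None b \<circ> q) = 0"
          by simp
      qed
    qed
  qed auto
  also have "\<dots> = (\<Sum>q | q permutes ?R. ?f q)"
    by simp
  also have "\<dots> = (\<Sum>p | p permutes UNIV. ?f (map_permutation UNIV Some p))"
  proof (rule sum.reindex_bij_betw[symmetric], rule bij_betwI')
    have bij: "bij_betw (Some :: 'n \<Rightarrow> 'n option) UNIV ?R"
      by (simp add: inj_on_imp_bij_betw)
    show "map_permutation UNIV Some p \<in> {q. q permutes ?R}" if "p \<in> {p. p permutes UNIV}" for p
      using map_permutation_permutes[OF bij] that by simp
    show "map_permutation UNIV Some p = map_permutation UNIV Some q \<longleftrightarrow> p = q"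
      if "p \<in> {p. p permutes UNIV}" "q \<in> {p. p permutes UNIV}" for p q :: "'n \<Rightarrow> 'n"
    proof
      assume "map_permutation UNIV Some p = map_permutation UNIV Some q"
      then have "Some (p i) = Some (q i)" for i
        by (metis map_permutation_apply UNIV_I inj_Some)
      then show "p = q" by auto
    qed simp
    show "\<exists>p\<in>{p. p permutes UNIV}. q = map_permutation UNIV Some p" if "q \<in> {q. q permutes ?R}" for q
    proof -
      let ?p = "map_permutation ?R the q"
      have q: "q permutes ?R"
        using that by simp
      have bij': "bij_betw the ?R (UNIV :: 'n set)"
        by (auto simp: bij_betw_def inj_on_def image_image)
      have "?p permutes UNIV"
        by (rule map_permutation_permutes[OF bij' q])
      moreover have "map_permutation UNIV Some ?p = q"
        by (rule map_permutation_compose_inv[OF bij' q]) auto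
      ultimately show ?thesis by force
    qed
  qed
  also have "\<dots> = (\<Sum>p | p permutes UNIV. A $ None $ None * (of_int (sign p) * (\<Prod>i\<in>UNIV. A $ Some i $ Some (p i))))"
  proof (rule sum.cong, simp, safe)
    fix p :: "'n \<Rightarrow> 'n" assume p: "p permutes UNIV"
    have s: "sign (map_permutation UNIV Some p) = sign p"
      by (rule sign_map_permutation) (use p in auto)
    have "map_permutation UNIV Some p permutes ?R"
      by (rule map_permutation_permutes[OF _ p]) (simp add: inj_on_imp_bij_betw)
    then have N: "map_permutation UNIV Some p None = None"
      by (auto simp: permutes_def)
    have S: "map_permutation UNIV Some p (Some i) = Some (p i)" for i
      by (simp add: map_permutation_apply)
    have "(\<Prod>i\<in>UNIV. A $ i $ map_permutation UNIV Some p i)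
        = A $ None $ None * (\<Prod>i\<in>?R. A $ i $ map_permutation UNIV Some p i)"
      unfolding U by (subst prod.insert) (auto simp: N)
    also have "\<dots> = A $ None $ None * (\<Prod>i\<in>UNIV. A $ Some i $ Some (p i))"
      by (simp add: prod.reindex S)
    finally show "?f (map_permutation UNIV Some p)
        = A $ None $ None * (of_int (sign p) * (\<Prod>i\<in>UNIV. A $ Some i $ Some (p i)))"
      by (simp add: s)
  qed
  also have "\<dots> = A $ None $ None * det (\<chi> i j. A $ Some i $ Some j)"
    by (simp add: det_def sum_distrib_left)
  finally show ?thesis .
qed

lemma det_option_column:
  fixes A :: "real ^ ('n::finite option) ^ ('n option)"
  assumes "\<And>i. A $ Some i $ None = 0"
  shows "det A = A $ None $ None * det (\<chi> i j. A $ Some i $ Some j)"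
proof -
  have "det A = det (transpose A)"
    by simp
  also have "\<dots> = A $ None $ None * det (transpose (\<chi> i j. A $ Some i $ Some j))"
    using assms by (subst det_option) (simp_all add: transpose_def)
  finally show ?thesis
    by simp
qed

text \<open>Each Leibniz term is differentiated as a product; regrouping by the differentiated
  factor gives determinants with one row replaced.\<close>

lemma has_derivative_det:
  fixes R :: "'n::finite \<Rightarrow> 'p::real_normed_vector \<Rightarrow> real ^ 'n"
  assumes "\<And>k. (R k has_derivative R' k) (at p)"
  shows "((\<lambda>q. det (\<chi> k. R k q)) has_derivative
    (\<lambda>v. \<Sum>k\<in>UNIV. det (\<chi> l. if l = k then R' k v else R l p))) (at p)"
proof -
  have D: "((\<lambda>q. \<Sum>\<pi> | \<pi> permutes UNIV. of_int (sign \<pi>) * (\<Prod>k\<in>UNIV. R k q $ \<pi> k)) has_derivative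
    (\<lambda>v. \<Sum>\<pi> | \<pi> permutes UNIV. of_int (sign \<pi>) *
       (\<Sum>k\<in>UNIV. R' k v $ \<pi> k * (\<Prod>l\<in>UNIV - {k}. R l p $ \<pi> l)))) (at p)"
    by (intro has_derivative_sum has_derivative_mult_right has_derivative_prod
        bounded_linear.has_derivative[OF bounded_linear_vec_nth] assms)
  have P: "(\<Prod>l\<in>UNIV. (if l = k then R' k v else R l p) $ \<pi> l)
      = R' k v $ \<pi> k * (\<Prod>l\<in>UNIV - {k}. R l p $ \<pi> l)" for k v \<pi>
    by (subst prod.remove[of _ k]) (auto intro!: prod.cong)
  have "(\<Sum>k\<in>UNIV. det (\<chi> l. if l = k then R' k v else R l p))
      = (\<Sum>\<pi> | \<pi> permutes UNIV. of_int (sign \<pi>) *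
       (\<Sum>k\<in>UNIV. R' k v $ \<pi> k * (\<Prod>l\<in>UNIV - {k}. R l p $ \<pi> l)))" for v
    unfolding det_def by (subst sum.swap) (simp add: P sum_distrib_left)
  then show ?thesis
    using D by (simp add: det_def)
qed

section \<open>Hypersurfaces with a transversal field\<close>

lemma pushforward_linear:
  assumes "immersed_hypersurface \<Omega> F" "p \<in> \<Omega>"
  shows "linear (pushforward F p)"
  using assms smooth_on_has_derivative has_derivative_linear
  unfolding immersed_hypersurface_def by blast

lemma tangent_transversal_unique:
  assumes "immersed_hypersurface \<Omega> F" "p \<in> \<Omega>" "x \<notin> range (pushforward F p)"
    "pushforward F p v + a *\<^sub>R x = pushforward F p w + b *\<^sub>R x"
  shows "v = w \<and> a = b"
proof -
  note L = pushforward_linear[OF assms(1,2)]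
  have *: "pushforward F p (v - w) = (b - a) *\<^sub>R x"
    using assms(4) by (simp add: linear_diff[OF L] algebra_simps)
  have "a = b"
  proof (rule ccontr)
    assume "a \<noteq> b"
    then have "x = pushforward F p ((1 / (b - a)) *\<^sub>R (v - w))"
      using * by (simp add: linear_cmul[OF L])
    then show False
      using assms(3) by blast
  qed
  moreover have "v = w"
    using assms(1,2,4) \<open>a = b\<close> unfolding immersed_hypersurface_def by (simp add: inj_eq)
  ultimately show ?thesis by simp
qed

text \<open>The linear map sending (v, a) to \<open>pushforward F p v + a *\<^sub>R x\<close> is
  injective between spaces of the same dimension n + 1, hence onto.\<close>

lemma tangent_transversal_decomposition:
  fixes F :: "'p::euclidean_space \<Rightarrow> real ^ 'n::finite option"
  assumes "immersed_hypersurface \<Omega> F" "p \<in> \<Omega>" "x \<notin> range (pushforward F p)"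
  obtains v a where "z = pushforward F p v + a *\<^sub>R x"
proof -
  let ?f = "\<lambda>(v, a). pushforward F p v + a *\<^sub>R x"
  note L = pushforward_linear[OF assms(1,2)]
  have lin: "linear ?f"
    by (rule linearI) (auto simp: linear_add[OF L] linear_cmul[OF L] algebra_simps)
  have "inj ?f"
    using tangent_transversal_unique[OF assms] by (auto simp: inj_def)
  then have "dim (range ?f) = dim (UNIV :: ('p \<times> real) set)"
    by (intro dim_image_eq lin) auto
  also have "\<dots> = DIM(real ^ 'n option)"
    using assms(1) by (simp add: immersed_hypersurface_def card_UNIV_option)
  finally have "span (range ?f) = UNIV"
    by (simp only: dim_eq_full)
  moreover have "span (range ?f) = range ?f"
    by (simp add: span_eq_iff linear_subspace_image[OF lin])
  ultimately have "z \<in> range ?f"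
    by blast
  then show ?thesis
    using that by auto
qed

lemma
  assumes "immersed_hypersurface \<Omega> F" "p \<in> \<Omega>" "\<xi> p \<notin> range (pushforward F p)"
  shows tangential_part_eq: "tangential_part F \<xi> p (pushforward F p v + a *\<^sub>R \<xi> p) = v"
    and transversal_part_eq: "transversal_part F \<xi> p (pushforward F p v + a *\<^sub>R \<xi> p) = a"
  unfolding tangential_part_def transversal_part_def
  by (rule the_equality; use tangent_transversal_unique[OF assms] in blast)+

lemma tangential_transversal_parts:
  assumes "immersed_hypersurface \<Omega> F" "p \<in> \<Omega>" "\<xi> p \<notin> range (pushforward F p)"
  shows "z = pushforward F p (tangential_part F \<xi> p z) + transversal_part F \<xi> p z *\<^sub>R \<xi> p"
proof -
  obtain v a where "z = pushforward F p v + a *\<^sub>R \<xi> p"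
    using tangent_transversal_decomposition[OF assms] by blast
  then show ?thesis
    by (simp add: tangential_part_eq[of \<Omega> F p \<xi>, OF assms] transversal_part_eq[of \<Omega> F p \<xi>, OF assms])
qed

text \<open>A covector that kills the tangent space reads off transversal parts up to a factor.
  Later this replaces the definite description in \<open>transversal_part\<close> by a quotient of
  inner products.\<close>

lemma transversal_part_conormal:
  assumes "immersed_hypersurface \<Omega> F" "p \<in> \<Omega>" "\<xi> p \<notin> range (pushforward F p)"
    and "\<And>v. N \<bullet> pushforward F p v = 0"
  shows "N \<bullet> z = transversal_part F \<xi> p z * (N \<bullet> \<xi> p)"
proof -
  have "N \<bullet> z = N \<bullet> (pushforward F p (tangential_part F \<xi> p z) + transversal_part F \<xi> p z *\<^sub>R \<xi> p)"
    using tangential_transversal_parts[of \<Omega> F p \<xi> z, OF assms(1-3)] by simp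
  then show ?thesis
    by (simp add: inner_add_right assms(4))
qed

text \<open>A linear relation between the rows would write 0 as a tangent vector plus a multiple of
  \<open>\<xi> p\<close>. Transversality makes both zero, and independence of the basis enumerated
  by \<open>E\<close> kills the remaining coefficients.\<close>

lemma induced_volume_nonzero:
  fixes F :: "'p::euclidean_space \<Rightarrow> real ^ 'n::finite option"
  assumes "immersed_hypersurface \<Omega> F" "p \<in> \<Omega>" "\<xi> p \<notin> range (pushforward F p)"
    and "bij_betw E (UNIV :: 'n set) Basis"
  shows "induced_volume F \<xi> p E \<noteq> 0"
proof
  assume "induced_volume F \<xi> p E = 0"
  let ?A = "(\<chi> k. case k of None \<Rightarrow> \<xi> p | Some i \<Rightarrow> pushforward F p (E i)) :: real ^ 'n option ^ 'n option"
  note L = pushforward_linear[OF assms(1,2)]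
  have "\<not> invertible (transpose ?A)"
    using \<open>induced_volume F \<xi> p E = 0\<close> by (simp add: invertible_det_nz induced_volume_def)
  then obtain c where c: "transpose ?A *v c = 0" "c \<noteq> 0"
    by (metis invertible_left_inverse matrix_left_invertible_ker)
  have "transpose ?A *v c = (\<Sum>k\<in>UNIV. c $ k *\<^sub>R (?A $ k))"
    by (simp add: matrix_vector_mult_def vec_eq_iff transpose_def mult.commute)
  also have "\<dots> = c $ None *\<^sub>R \<xi> p + (\<Sum>i\<in>UNIV. c $ Some i *\<^sub>R pushforward F p (E i))"
    by (simp add: UNIV_option_conv sum.reindex)
  also have "\<dots> = pushforward F p (\<Sum>i\<in>UNIV. c $ Some i *\<^sub>R E i) + c $ None *\<^sub>R \<xi> p"
    by (simp add: linear_sum[OF L] linear_cmul[OF L])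
  finally have "pushforward F p (\<Sum>i\<in>UNIV. c $ Some i *\<^sub>R E i) + c $ None *\<^sub>R \<xi> p
      = pushforward F p 0 + 0 *\<^sub>R \<xi> p"
    using c linear_0[OF L] by simp
  then have *: "(\<Sum>i\<in>UNIV. c $ Some i *\<^sub>R E i) = 0" "c $ None = 0"
    using tangent_transversal_unique[OF assms(1-3)] by blast+
  have "c $ Some j = 0" for j
  proof -
    have "E i \<in> Basis" "E i = E j \<longleftrightarrow> i = j" for i
      using assms(4) by (auto simp: bij_betw_def inj_eq)
    then have E: "E i \<bullet> E j = (if i = j then 1 else 0)" for i
      by (simp add: inner_Basis)
    have "(\<Sum>i\<in>UNIV. c $ Some i *\<^sub>R E i) \<bullet> E j = 0"
      using * by simp
    then show ?thesis
      by (simp add: inner_sum_left E if_distrib cong: if_cong)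
  qed
  then have "c = 0"
    using *(2) by (metis option.exhaust vec_eq_iff zero_index)
  then show False
    using c by simp
qed

text \<open>The tangent space has dimension n, one less than the ambient space; a nonzero vector
  orthogonal to it lies in the kernel of the matrix.\<close>

lemma det_tangent_rows:
  fixes F :: "'p::euclidean_space \<Rightarrow> real ^ 'n::finite option"
  assumes "immersed_hypersurface \<Omega> F" "p \<in> \<Omega>" "\<And>k. A $ k \<in> range (pushforward F p)"
  shows "det (A :: real ^ 'n option ^ 'n option) = 0"
proof -
  have "dim (range (pushforward F p)) \<le> DIM('p)"
    using dim_image_le[OF pushforward_linear[OF assms(1,2)], of UNIV] by simp
  also have "\<dots> < DIM(real ^ 'n option)"
    using assms(1) by (simp add: immersed_hypersurface_def)
  finally obtain N where N: "N \<noteq> 0" "\<And>y. y \<in> span (range (pushforward F p)) \<Longrightarrow> orthogonal N y"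
    using orthogonal_to_subspace_exists by metis
  have "N \<bullet> (A $ k) = 0" for k
    using N(2)[OF span_base[OF assms(3)[of k]]] by (simp add: orthogonal_def)
  then have "A *v N = 0"
    by (simp add: matrix_vector_mult_def vec_eq_iff inner_vec_def mult.commute)
  then have "\<not> invertible A"
    using N(1) by (metis invertible_left_inverse matrix_left_invertible_ker)
  then show ?thesis
    by (simp add: invertible_det_nz)
qed

text \<open>\<open>\<nabla>\<omega> = \<tau> \<otimes> \<omega>\<close>, since replacing a tangent row of \<open>\<omega>\<close> by a multiple of \<open>\<xi>\<close> gives zero.\<close>

lemma covariant_derivative_induced_volume:
  fixes F :: "'p::euclidean_space \<Rightarrow> real ^ 'n::finite option"
  assumes "immersed_hypersurface \<Omega> F" "transversal_field \<Omega> F \<xi>" "p \<in> \<Omega>"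
    and X: "\<And>i :: 'n. smooth_on \<Omega> (X i)"
  shows "frechet_derivative (\<lambda>q. induced_volume F \<xi> q (\<lambda>i. X i q)) (at p) v
      - (\<Sum>j\<in>UNIV. induced_volume F \<xi> p ((\<lambda>i. X i p)(j := induced_connection F \<xi> p v (X j))))
    = transversal_part F \<xi> p (pushforward \<xi> p v) * induced_volume F \<xi> p (\<lambda>i. X i p)"
proof -
  have op: "open \<Omega>" and sF: "smooth_on \<Omega> F"
    using assms(1) by (auto simp: immersed_hypersurface_def)
  have s\<xi>: "smooth_on \<Omega> \<xi>" and tr: "\<xi> p \<notin> range (pushforward F p)"
    using assms(2,3) by (auto simp: transversal_field_def)
  define R where "R k q = (case k of None \<Rightarrow> \<xi> q | Some i \<Rightarrow> pushforward F q (X i q))" for k q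
  define R' where "R' k = (case k of None \<Rightarrow> pushforward \<xi> p
      | Some i \<Rightarrow> pushforward (\<lambda>q. pushforward F q (X i q)) p)" for k
  have "(R k has_derivative R' k) (at p)" for k
    using smooth_on_has_derivative[OF s\<xi> assms(3)]
      smooth_on_has_derivative[OF smooth_on_pushforward_field[OF op sF X] assms(3)]
    by (cases k) (simp_all add: R_def[abs_def] R'_def)
  from has_derivative_det[of R, OF this]
  have "frechet_derivative (\<lambda>q. induced_volume F \<xi> q (\<lambda>i. X i q)) (at p) v
      = (\<Sum>k\<in>UNIV. det (\<chi> l. if l = k then R' k v else R l p))"
    using pushforward_eqI by (fastforce simp: induced_volume_def R_def)
  also have "\<dots> = det (\<chi> l. if l = None then R' None v else R l p)
      + (\<Sum>j\<in>UNIV. det (\<chi> l. if l = Some j then R' (Some j) v else R l p))"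
    by (simp add: UNIV_option_conv sum.reindex)
  also have "det (\<chi> l. if l = None then R' None v else R l p)
      = transversal_part F \<xi> p (pushforward \<xi> p v) * induced_volume F \<xi> p (\<lambda>i. X i p)"
  proof -
    let ?z = "pushforward \<xi> p v"
    let ?T = "pushforward F p (tangential_part F \<xi> p ?z)" and ?t = "transversal_part F \<xi> p ?z"
    have eq: "R' None v = ?T + ?t *s \<xi> p"
      using tangential_transversal_parts[of \<Omega> F p \<xi>, OF assms(1,3) tr]
      by (simp add: R'_def scalar_mult_eq_scaleR)
    have "det (\<chi> l. if l = None then R' None v else R l p)
        = det (\<chi> l. if l = None then ?T else R l p) + ?t * det (\<chi> l. if l = None then \<xi> p else R l p)"
      unfolding eq using det_row_add[of None "\<lambda>_. ?T" "\<lambda>_. ?t *s \<xi> p" "\<lambda>l. R l p"]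
        det_row_mul[of None ?t "\<lambda>_. \<xi> p" "\<lambda>l. R l p"] by simp
    \<comment> \<open>All n + 1 rows are tangent now, so only the transversal part of the derivative
      of \<open>\<xi>\<close> contributes.\<close>
    also have "det (\<chi> l. if l = None then ?T else R l p) = 0"
      by (rule det_tangent_rows[OF assms(1,3)]) (auto simp: R_def split: option.split)
    also have "(\<chi> l. if l = None then \<xi> p else R l p)
        = (\<chi> k. case k of None \<Rightarrow> \<xi> p | Some i \<Rightarrow> pushforward F p (X i p))"
      by (simp add: vec_eq_iff R_def split: option.split)
    finally show ?thesis
      by (simp add: induced_volume_def)
  qed
  finally have total: "frechet_derivative (\<lambda>q. induced_volume F \<xi> q (\<lambda>i. X i q)) (at p) v
      = transversal_part F \<xi> p (pushforward \<xi> p v) * induced_volume F \<xi> p (\<lambda>i. X i p)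
        + (\<Sum>j\<in>UNIV. det (\<chi> l. if l = Some j then R' (Some j) v else R l p))" .
  have "det (\<chi> l. if l = Some j then R' (Some j) v else R l p)
      = induced_volume F \<xi> p ((\<lambda>i. X i p)(j := induced_connection F \<xi> p v (X j)))" for j
  proof -
    let ?z = "pushforward (\<lambda>q. pushforward F q (X j q)) p v"
    let ?T = "pushforward F p (tangential_part F \<xi> p ?z)" and ?t = "transversal_part F \<xi> p ?z"
    have eq: "R' (Some j) v = ?T + ?t *s \<xi> p"
      using tangential_transversal_parts[of \<Omega> F p \<xi>, OF assms(1,3) tr]
      by (simp add: R'_def scalar_mult_eq_scaleR)
    have "det (\<chi> l. if l = Some j then R' (Some j) v else R l p)
        = det (\<chi> l. if l = Some j then ?T else R l p) + ?t * det (\<chi> l. if l = Some j then \<xi> p else R l p)"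
      unfolding eq using det_row_add[of "Some j" "\<lambda>_. ?T" "\<lambda>_. ?t *s \<xi> p" "\<lambda>l. R l p"]
        det_row_mul[of "Some j" ?t "\<lambda>_. \<xi> p" "\<lambda>l. R l p"] by simp
    \<comment> \<open>Rows \<open>None\<close> and \<open>Some j\<close> coincide. What remains of
      row \<open>Some j\<close> is the tangential part, which is the covariant derivative of
      \<open>X j\<close>.\<close>
    also have "det (\<chi> l. if l = Some j then \<xi> p else R l p) = 0"
      by (rule det_identical_rows[of None "Some j"]) (simp_all add: row_def R_def)
    also have "(\<chi> l. if l = Some j then ?T else R l p) = (\<chi> k. case k of None \<Rightarrow> \<xi> p
        | Some i \<Rightarrow> pushforward F p (((\<lambda>i. X i p)(j := induced_connection F \<xi> p v (X j))) i))"
      by (simp add: vec_eq_iff R_def induced_connection_def split: option.split)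
    finally show ?thesis
      by (simp only: induced_volume_def mult_zero_right add_0_right)
  qed
  then show ?thesis
    by (simp only: total add_diff_cancel_right')
qed

text \<open>Turns a condition on all n-tuples of fields into a pointwise one on \<open>\<xi>\<close>
  alone. For the forward direction a frame of constant fields is inserted, whose volume is nonzero
  and cancels.\<close>

lemma parallel_volume_iff:
  fixes F :: "'p::euclidean_space \<Rightarrow> real ^ 'n::finite option"
  assumes "immersed_hypersurface \<Omega> F" "transversal_field \<Omega> F \<xi>"
  shows "parallel_volume \<Omega> F \<xi> \<longleftrightarrow> (\<forall>p\<in>\<Omega>. \<forall>v. transversal_part F \<xi> p (pushforward \<xi> p v) = 0)"
proof
  assume par: "parallel_volume \<Omega> F \<xi>"
  have "card (Basis :: 'p set) = CARD('n)"
    using assms(1) by (simp add: immersed_hypersurface_def)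
  then obtain E :: "'n \<Rightarrow> 'p" where E: "bij_betw E UNIV Basis"
    using finite_same_card_bij[of "UNIV :: 'n set" "Basis :: 'p set"] by auto
  have "transversal_part F \<xi> p (pushforward \<xi> p v) = 0" if "p \<in> \<Omega>" for p v
  proof -
    have "transversal_part F \<xi> p (pushforward \<xi> p v) * induced_volume F \<xi> p E = 0"
      using covariant_derivative_induced_volume[OF assms that, of "\<lambda>i q. E i" v] par that
      by (simp add: parallel_volume_def smooth_on_const)
    moreover have "induced_volume F \<xi> p E \<noteq> 0"
      using assms that by (intro induced_volume_nonzero[OF _ _ _ E]) (auto simp: transversal_field_def)
    ultimately show ?thesis by simp
  qed
  then show "\<forall>p\<in>\<Omega>. \<forall>v. transversal_part F \<xi> p (pushforward \<xi> p v) = 0"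
    by blast
next
  assume "\<forall>p\<in>\<Omega>. \<forall>v. transversal_part F \<xi> p (pushforward \<xi> p v) = 0"
  then show "parallel_volume \<Omega> F \<xi>"
    unfolding parallel_volume_def by (simp add: covariant_derivative_induced_volume[OF assms])
qed

section \<open>Levi-Civita connections\<close>

lemma is_levi_civita_torsion:
  "is_levi_civita \<Omega> h C \<Longrightarrow> smooth_on \<Omega> X \<Longrightarrow> smooth_on \<Omega> Y \<Longrightarrow> p \<in> \<Omega>
    \<Longrightarrow> C p (X p) Y - C p (Y p) X = lie_bracket X Y p"
  by (simp add: is_levi_civita_def)

lemma is_levi_civita_metric:
  "is_levi_civita \<Omega> h C \<Longrightarrow> smooth_on \<Omega> Y \<Longrightarrow> smooth_on \<Omega> Z \<Longrightarrow> p \<in> \<Omega>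
    \<Longrightarrow> pushforward (\<lambda>q. h q (Y q) (Z q)) p v = h p (C p v Y) (Z p) + h p (Y p) (C p v Z)"
  by (simp add: is_levi_civita_def)

text \<open>The difference T of the two connections is symmetric by the torsion condition, and
  \<open>h p (T v w) z\<close> is skew in w and z by the metric condition; both together force it to
  vanish. Constant fields suffice, because \<open>difference_tensor\<close> evaluates connections on
  them.\<close>

lemma levi_civita_unique_const:
  assumes C: "is_levi_civita \<Omega> h C" and C': "is_levi_civita \<Omega> h C'" and p: "p \<in> \<Omega>"
    and bil: "bilinear (h p)" and sym: "\<And>v w. h p v w = h p w v" and pos: "positive_definite (h p)"
  shows "C p v (\<lambda>_. w) = C' p v (\<lambda>_. w)"
proof -
  define T where "T v w = C p v (\<lambda>_. w) - C' p v (\<lambda>_. w)" for v w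
  have "C p v (\<lambda>_. w) - C p w (\<lambda>_. v) = C' p v (\<lambda>_. w) - C' p w (\<lambda>_. v)" for v w
    using is_levi_civita_torsion[OF C smooth_on_const smooth_on_const p, of v w]
      is_levi_civita_torsion[OF C' smooth_on_const smooth_on_const p, of v w] by simp
  then have T_sym: "T v w = T w v" for v w
    by (simp add: T_def algebra_simps)
  have metric: "h p (C p v (\<lambda>_. w)) z + h p w (C p v (\<lambda>_. z))
      = h p (C' p v (\<lambda>_. w)) z + h p w (C' p v (\<lambda>_. z))" for v w z
    using is_levi_civita_metric[OF C smooth_on_const smooth_on_const p, of w z v]
      is_levi_civita_metric[OF C' smooth_on_const smooth_on_const p, of w z v] by simp
  have T_skew: "h p (T v w) z = - h p (T v z) w" for v w z
    using metric[of v w z] sym[of w "C p v (\<lambda>_. z)"] sym[of w "C' p v (\<lambda>_. z)"]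
    by (simp add: T_def bilinear_lsub[OF bil] bilinear_rsub[OF bil] algebra_simps)
  have "h p (T v w) z = 0" for v w z
  proof -
    \<comment> \<open>Skewness in the last two places and symmetry in the first two, combined, cycle
      the arguments; three rounds return to the start with sign (-1)^3.\<close>
    have "h p (T v w) z = - h p (T z v) w" using T_skew[of v w z] T_sym[of v z] by simp
    also have "\<dots> = h p (T w z) v" using T_skew[of z v w] T_sym[of z w] by simp
    also have "\<dots> = - h p (T v w) z" using T_skew[of w z v] T_sym[of w v] by simp
    finally show ?thesis by simp
  qed
  then have "h p (T v w) (T v w) = 0"
    by blast
  then have "T v w = 0"
    using pos unfolding positive_definite_def by (metis less_irrefl)
  then show ?thesis
    by (simp add: T_def)
qed

section \<open>Metrics a(t) dt^2 + b(t) |du|^2 and their Levi-Civita connection\<close>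

lemma has_derivative_fst_fun:
  fixes p :: "real \<times> 'b::real_normed_vector"
  assumes "smooth_on I \<gamma>" "fst p \<in> I"
  shows "((\<lambda>q. \<gamma> (fst q)) has_derivative (\<lambda>v. fst v * deriv \<gamma> (fst p))) (at p)"
  using smooth_on_real_has_derivative[OF assms]
  by (rule DERIV_compose_FDERIV[where g = fst]) (rule has_derivative_fst[OF has_derivative_ident])

lemma smooth_on_fst_fun:
  fixes \<gamma> :: "real \<Rightarrow> 'c::real_normed_vector"
  assumes "open I" "open (U :: 'b::real_normed_vector set)" "smooth_on I \<gamma>"
  shows "smooth_on (I \<times> U) (\<lambda>q. \<gamma> (fst q))"
  using assms(1,2)
  by (intro smooth_on_compose[OF _ _ assms(3)] smooth_on_linear[OF bounded_linear_fst] open_Times) auto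

lemma smooth_on_Pair:
  assumes "open \<Omega>" "smooth_on \<Omega> f" "smooth_on \<Omega> g"
  shows "smooth_on \<Omega> (\<lambda>p. (f p, g p))"
proof -
  have "bounded_linear (\<lambda>x. (x, 0))" "bounded_linear (\<lambda>x. (0, x))"
    by (intro bounded_linear_Pair bounded_linear_ident bounded_linear_zero)+
  from smooth_on_add[OF assms(1) smooth_on_bounded_linear[OF this(1) assms(1,2)]
      smooth_on_bounded_linear[OF this(2) assms(1,3)]]
  show ?thesis
    by simp
qed

definition warped_metric ::
  "(real \<Rightarrow> real) \<Rightarrow> (real \<Rightarrow> real) \<Rightarrow> real \<times> 'b::euclidean_space
    \<Rightarrow> real \<times> 'b \<Rightarrow> real \<times> 'b \<Rightarrow> real" where
  "warped_metric a b p v w = a (fst p) * (fst v * fst w) + b (fst p) * (snd v \<bullet> snd w)"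

text \<open>The Christoffel symbols of a dt^2 + b |du|^2: the only ones that can be nonzero are
  a'/2a for (t; t,t), -b'/2a for (t; i,i) and b'/2b for (i; t,i), upper index in front.\<close>

definition warped_christoffel ::
  "(real \<Rightarrow> real) \<Rightarrow> (real \<Rightarrow> real) \<Rightarrow> real \<times> 'b::euclidean_space
    \<Rightarrow> real \<times> 'b \<Rightarrow> real \<times> 'b \<Rightarrow> real \<times> 'b" where
  "warped_christoffel a b p v w =
    (deriv a (fst p) / (2 * a (fst p)) * (fst v * fst w) - deriv b (fst p) / (2 * a (fst p)) * (snd v \<bullet> snd w),
     (deriv b (fst p) / (2 * b (fst p))) *\<^sub>R (fst v *\<^sub>R snd w + fst w *\<^sub>R snd v))"

lemma bilinear_warped_metric: "bilinear (warped_metric a b p)"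
  by (auto simp: bilinear_def warped_metric_def inner_simps algebra_simps intro!: linearI)

lemma warped_metric_sym: "warped_metric a b p v w = warped_metric a b p w v"
  by (simp add: warped_metric_def mult.commute inner_commute)

lemma positive_definite_warped_metric:
  assumes "a (fst p) > 0" "b (fst p) > 0"
  shows "positive_definite (warped_metric a b p)"
  unfolding positive_definite_def
proof safe
  fix v :: "real \<times> 'a" assume "v \<noteq> 0"
  then consider "fst v \<noteq> 0" | "snd v \<noteq> 0"
    by (auto simp: prod_eq_iff)
  then show "0 < warped_metric a b p v v"
  proof cases
    case 1
    then have "0 < fst v * fst v"
      by (auto simp: zero_less_mult_iff linorder_neq_iff)
    then show ?thesis
      unfolding warped_metric_def using assms by (intro add_pos_nonneg) auto
  next
    case 2
    then show ?thesis
      unfolding warped_metric_def using assms by (intro add_nonneg_pos) auto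
  qed
qed

lemma warped_christoffel_linear:
  "linear (\<lambda>v. warped_christoffel a b p v w)"
  "warped_christoffel a b p v (w + w') = warped_christoffel a b p v w + warped_christoffel a b p v w'"
  "warped_christoffel a b p v (c *\<^sub>R w) = c *\<^sub>R warped_christoffel a b p v w"
    apply (rule linearI)
  by (simp_all add: warped_christoffel_def inner_simps prod_eq_iff ring_distribs scaleR_add_right
      scaleR_add_left right_diff_distrib mult.assoc mult.left_commute)

lemma warped_christoffel_sym: "warped_christoffel a b p v w = warped_christoffel a b p w v"
  by (simp add: warped_christoffel_def inner_commute add.commute mult.commute)

text \<open>The right-hand side is the derivative of the metric coefficients along v. With the
  product rule for the two fields this becomes compatibility with the metric.\<close>

lemma warped_christoffel_metric:
  assumes "a (fst p) \<noteq> 0" "b (fst p) \<noteq> 0"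
  shows "warped_metric a b p (warped_christoffel a b p v y) z + warped_metric a b p y (warped_christoffel a b p v z)
    = fst v * deriv a (fst p) * (fst y * fst z) + fst v * deriv b (fst p) * (snd y \<bullet> snd z)"
  using assms
  by (simp add: warped_metric_def warped_christoffel_def inner_simps inner_commute field_simps)

definition warped_connection where
  "warped_connection a b p v Y = pushforward Y p v + warped_christoffel a b p v (Y p)"

text \<open>The candidate is the flat derivative plus the Christoffel terms: the flat part produces
  the Lie bracket, and the symmetric rest cancels in the torsion. The form \<open>h\<close> is
  prescribed only on the domain, whose openness determines its derivatives there.\<close>

lemma is_levi_civita_warped:
  fixes U :: "'b::euclidean_space set"
  assumes opn: "open I" "open U" and sm: "smooth_on I a" "smooth_on I b"
    and nz: "\<And>t. t \<in> I \<Longrightarrow> a t \<noteq> 0 \<and> b t \<noteq> 0"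
    and h: "\<And>p. p \<in> I \<times> U \<Longrightarrow> h p = warped_metric a b p"
  shows "is_levi_civita (I \<times> U) h (warped_connection a b)"
proof -
  let ?\<Omega> = "I \<times> U"
  have op: "open ?\<Omega>"
    using opn by (rule open_Times)
  have smf: "smooth_on ?\<Omega> (\<lambda>q. \<gamma> (fst q))" if "smooth_on I \<gamma>" for \<gamma> :: "real \<Rightarrow> real"
    using smooth_on_fst_fun[OF opn that] .
  note D = smooth_on_has_derivative
  show ?thesis
    unfolding is_levi_civita_def affine_connection_def
  proof (intro conjI allI impI ballI; (elim conjE)?)
    fix X Y :: "real \<times> 'b \<Rightarrow> real \<times> 'b"
    assume X: "smooth_on ?\<Omega> X" and Y: "smooth_on ?\<Omega> Y"
    have fs: "smooth_on ?\<Omega> (\<lambda>q. fst (Z q))" "smooth_on ?\<Omega> (\<lambda>q. snd (Z q))"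
      if "smooth_on ?\<Omega> Z" for Z :: "real \<times> 'b \<Rightarrow> real \<times> 'b"
      using smooth_on_bounded_linear[OF bounded_linear_fst op that]
        smooth_on_bounded_linear[OF bounded_linear_snd op that] .
    have "smooth_on ?\<Omega> (\<lambda>p. warped_christoffel a b p (X p) (Y p))"
      unfolding warped_christoffel_def
      by (intro smooth_on_Pair smooth_on_add smooth_on_diff smooth_on_mult smooth_on_scaleR smooth_on_divide
          smooth_on_inner smf sm smooth_on_deriv fs X Y op opn smooth_on_const)
        (use nz in auto)
    then show "smooth_on ?\<Omega> (\<lambda>p. warped_connection a b p (X p) Y)"
      unfolding warped_connection_def by (intro smooth_on_add smooth_on_pushforward_field X Y op)
  next
    fix Y :: "real \<times> 'b \<Rightarrow> real \<times> 'b" and p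
    assume "smooth_on ?\<Omega> Y" "p \<in> ?\<Omega>"
    then have "linear (pushforward Y p)"
      using D has_derivative_linear by blast
    then show "linear (\<lambda>v. warped_connection a b p v Y)"
      unfolding warped_connection_def by (intro linear_compose_add warped_christoffel_linear(1))
  next
    fix Y Z :: "real \<times> 'b \<Rightarrow> real \<times> 'b" and p v
    assume *: "smooth_on ?\<Omega> Y" "smooth_on ?\<Omega> Z" "p \<in> ?\<Omega>"
    have "pushforward (\<lambda>q. Y q + Z q) p = (\<lambda>v. pushforward Y p v + pushforward Z p v)"
      using * by (intro pushforward_eqI has_derivative_add D)
    then show "warped_connection a b p v (\<lambda>q. Y q + Z q)
        = warped_connection a b p v Y + warped_connection a b p v Z"
      by (simp add: warped_connection_def warped_christoffel_linear(2))
  next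
    fix f :: "real \<times> 'b \<Rightarrow> real" and Y :: "real \<times> 'b \<Rightarrow> real \<times> 'b" and p v
    assume *: "smooth_on ?\<Omega> f" "smooth_on ?\<Omega> Y" "p \<in> ?\<Omega>"
    have "pushforward (\<lambda>q. f q *\<^sub>R Y q) p = (\<lambda>v. f p *\<^sub>R pushforward Y p v + pushforward f p v *\<^sub>R Y p)"
      using * by (intro pushforward_eqI has_derivative_scaleR D)
    then show "warped_connection a b p v (\<lambda>q. f q *\<^sub>R Y q)
        = pushforward f p v *\<^sub>R Y p + f p *\<^sub>R warped_connection a b p v Y"
      by (simp add: warped_connection_def warped_christoffel_linear(3) scaleR_add_right)
  next
    fix X Y :: "real \<times> 'b \<Rightarrow> real \<times> 'b" and p
    show "warped_connection a b p (X p) Y - warped_connection a b p (Y p) X = lie_bracket X Y p"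
      by (simp add: warped_connection_def lie_bracket_def warped_christoffel_sym[of a b p "Y p" "X p"])
  next
    fix Y Z :: "real \<times> 'b \<Rightarrow> real \<times> 'b" and p v
    assume *: "smooth_on ?\<Omega> Y" "smooth_on ?\<Omega> Z" "p \<in> ?\<Omega>"
    then have t: "fst p \<in> I" by auto
    note DY = D[OF *(1,3)] and DZ = D[OF *(2,3)]
    have "((\<lambda>q. warped_metric a b q (Y q) (Z q)) has_derivative
      (\<lambda>v. a (fst p) * (fst (Y p) * fst (pushforward Z p v) + fst (pushforward Y p v) * fst (Z p))
         + fst v * deriv a (fst p) * (fst (Y p) * fst (Z p))
         + (b (fst p) * (snd (Y p) \<bullet> snd (pushforward Z p v) + snd (pushforward Y p v) \<bullet> snd (Z p))
         + fst v * deriv b (fst p) * (snd (Y p) \<bullet> snd (Z p))))) (at p)"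
      unfolding warped_metric_def
      by (intro has_derivative_add has_derivative_mult has_derivative_inner has_derivative_fst_fun[OF _ t]
          has_derivative_fst has_derivative_snd DY DZ sm)
    then have "pushforward (\<lambda>q. warped_metric a b q (Y q) (Z q)) p v
      = warped_metric a b p (pushforward Y p v) (Z p) + warped_metric a b p (Y p) (pushforward Z p v)
        + (fst v * deriv a (fst p) * (fst (Y p) * fst (Z p))
           + fst v * deriv b (fst p) * (snd (Y p) \<bullet> snd (Z p)))"
      by (simp add: pushforward_eqI warped_metric_def algebra_simps)
    also have "\<dots> = warped_metric a b p (warped_connection a b p v Y) (Z p)
        + warped_metric a b p (Y p) (warped_connection a b p v Z)"
      using nz[OF t] by (simp add: warped_christoffel_metric[symmetric] warped_connection_def
          bilinear_ladd[OF bilinear_warped_metric] bilinear_radd[OF bilinear_warped_metric])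
    finally show "pushforward (\<lambda>q. h q (Y q) (Z q)) p v
        = h p (warped_connection a b p v Y) (Z p) + h p (Y p) (warped_connection a b p v Z)"
      using * h pushforward_cong[OF op *(3), of "\<lambda>q. h q (Y q) (Z q)" "\<lambda>q. warped_metric a b q (Y q) (Z q)"]
      by simp
  qed
qed

text \<open>The explicit connection witnesses that the chosen one satisfies the axioms; uniqueness
  then identifies them on constant fields, where the flat part vanishes.\<close>

lemma levi_civita_warped:
  fixes U :: "'b::euclidean_space set"
  assumes "open I" "open U" "smooth_on I a" "smooth_on I b"
    and pos: "\<And>t. t \<in> I \<Longrightarrow> a t > 0 \<and> b t > 0"
    and h: "\<And>p. p \<in> I \<times> U \<Longrightarrow> h p = warped_metric a b p" and p: "p \<in> I \<times> U"
  shows "levi_civita (I \<times> U) h p v (\<lambda>_. w) = warped_christoffel a b p v w"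
proof -
  have "a t \<noteq> 0 \<and> b t \<noteq> 0" if "t \<in> I" for t
    using pos[OF that] by auto
  with assms(1-4) h have W: "is_levi_civita (I \<times> U) h (warped_connection a b)"
    by (intro is_levi_civita_warped)
  then have L: "is_levi_civita (I \<times> U) h (levi_civita (I \<times> U) h)"
    unfolding levi_civita_def by (rule someI[of "is_levi_civita (I \<times> U) h"])
  have "levi_civita (I \<times> U) h p v (\<lambda>_. w) = warped_connection a b p v (\<lambda>_. w)"
  proof (rule levi_civita_unique_const[OF L W p])
    show "positive_definite (h p)"
      unfolding h[OF p] using pos p by (intro positive_definite_warped_metric) auto
  qed (simp_all only: h[OF p] bilinear_warped_metric warped_metric_sym)
  then show ?thesis
    by (simp add: warped_connection_def)
qed

section \<open>The hypersurface generated by a curve\<close>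

lemma sum_UNIV_option: "(\<Sum>k\<in>UNIV. f k) = f None + (\<Sum>i\<in>UNIV. f (Some i))"
  for f :: "'n::finite option \<Rightarrow> 'a::comm_monoid_add"
  by (simp add: UNIV_option_conv sum.reindex)

lemma prod_UNIV_option: "(\<Prod>k\<in>UNIV. f k) = f None * (\<Prod>i\<in>UNIV. f (Some i))"
  for f :: "'n::finite option \<Rightarrow> 'a::comm_monoid_mult"
  by (simp add: UNIV_option_conv prod.reindex)

lemma coords_nth [simp]:
  "coords x y z $ None = z" "coords x y z $ Some None = y" "coords x y z $ Some (Some i) = x $ i"
  by (simp_all add: coords_def)

lemma vec_eq_coords_iff:
  "v = w \<longleftrightarrow> v $ None = w $ None \<and> v $ Some None = w $ Some None \<and> (\<forall>i. v $ Some (Some i) = w $ Some (Some i))"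
  for v w :: "'a ^ 'm::finite option option"
  by (simp add: vec_eq_iff split_option_all)

lemma coords_eq_iff: "coords x y z = coords x' y' z' \<longleftrightarrow> x = x' \<and> y = y' \<and> z = z'"
  by (auto simp: vec_eq_coords_iff vec_eq_iff)

lemma coords_0_0_Some: "coords 0 0 z $ Some j = 0"
  by (cases j) simp_all

lemma coords_add: "coords x y z + coords x' y' z' = coords (x + x') (y + y') (z + z')"
  by (simp add: vec_eq_coords_iff)

lemma coords_scaleR: "c *\<^sub>R coords x y z = coords (c *\<^sub>R x) (c * y) (c * z)"
  by (simp add: vec_eq_coords_iff)

lemma coords_0: "coords 0 0 0 = 0"
  by (simp add: vec_eq_coords_iff)

lemma inner_coords: "coords x y z \<bullet> coords x' y' z' = x \<bullet> x' + y * y' + z * z'"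
  by (simp add: inner_vec_def sum_UNIV_option)

lemma e_n_coords: "e_n = coords 0 1 0"
  by (simp add: e_n_def vec_eq_coords_iff axis_def)

lemma bounded_linear_coords: "bounded_linear (\<lambda>w :: (real ^ 'm::finite) \<times> real \<times> real. coords (fst w) (fst (snd w)) (snd (snd w)))"
  unfolding linear_conv_bounded_linear[symmetric]
  by (rule linearI) (simp_all add: coords_add coords_scaleR)

lemma has_derivative_coords:
  assumes "(f has_derivative f') (at p)" "(g has_derivative g') (at p)" "(h has_derivative h') (at p)"
  shows "((\<lambda>q. coords (f q) (g q) (h q)) has_derivative (\<lambda>v. coords (f' v) (g' v) (h' v))) (at p)"
  using bounded_linear.has_derivative[OF bounded_linear_coords
      has_derivative_Pair[OF assms(1) has_derivative_Pair[OF assms(2,3)]]] by simp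

lemma smooth_on_coords:
  assumes "open \<Omega>" "smooth_on \<Omega> f" "smooth_on \<Omega> g" "smooth_on \<Omega> h"
  shows "smooth_on \<Omega> (\<lambda>q. coords (f q) (g q) (h q))"
  using smooth_on_bounded_linear[OF bounded_linear_coords assms(1)
      smooth_on_Pair[OF assms(1,2) smooth_on_Pair[OF assms(1,3,4)]]] by simp

lemma det_scale_columns:
  fixes A :: "real ^ 'n::finite ^ 'n"
  shows "det (\<chi> i j. A $ i $ j * d j) = det A * (\<Prod>j\<in>UNIV. d j)"
proof -
  have "det (\<chi> i j. A $ i $ j * d j) = det (transpose (\<chi> i j. A $ i $ j * d j))"
    by simp
  also have "transpose (\<chi> i j. A $ i $ j * d j) = (\<chi> j. d j *s (\<chi> i. A $ i $ j))"
    by (simp add: transpose_def vec_eq_iff mult.commute)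
  also have "det \<dots> = (\<Prod>j\<in>UNIV. d j) * det (transpose A)"
    by (simp add: det_rows_mul transpose_def)
  finally show ?thesis
    by (simp add: mult.commute)
qed

text \<open>Intermediate value theorem. It makes the pointwise choices of sign for
  \<open>\<mu>\<close> uniform on the interval.\<close>

lemma constant_sign_on_interval:
  fixes f :: "real \<Rightarrow> real"
  assumes "is_interval I" "continuous_on I f" "\<And>t. t \<in> I \<Longrightarrow> f t \<noteq> 0"
  shows "\<exists>e\<in>{1, -1}. \<forall>t\<in>I. e * f t > 0"
proof -
  have J: "is_interval (f ` I)"
    using assms(1,2) connected_continuous_image is_interval_connected_1 by blast
  have False if "s \<in> I" "t \<in> I" "f s < 0" "0 < f t" for s t
  proof -
    have "0 \<in> f ` I"
      using J that unfolding is_interval_1 by (meson image_eqI less_imp_le)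
    then show False
      using assms(3) by force
  qed
  then have "(\<forall>t\<in>I. f t > 0) \<or> (\<forall>t\<in>I. f t < 0)"
    using assms(3) by (meson linorder_neqE_linordered_idom)
  then show ?thesis
    by auto
qed

section \<open>The hypersurface relative to the constant transversal field
  \<open>e_n\<close>\<close>

locale curve_data =
  fixes I :: "real set" and U :: "(real ^ 'm::finite) set" and \<gamma>1 \<gamma>2 :: "real \<Rightarrow> real"
  assumes open_I: "open I" and int_I: "is_interval I" and open_U: "open U"
    and sm1: "smooth_on I \<gamma>1" and sm2: "smooth_on I \<gamma>2"
    and cond: "\<And>t. t \<in> I \<Longrightarrow> deriv \<gamma>1 t * \<gamma>1 t * curve_det \<gamma>1 \<gamma>2 t > 0"
begin

abbreviation "\<Omega> \<equiv> I \<times> U"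
abbreviation "F \<equiv> curve_hypersurface \<gamma>1 \<gamma>2 :: real \<times> (real ^ 'm) \<Rightarrow> real ^ 'm option option"
abbreviation "g' \<equiv> deriv \<gamma>1"
abbreviation "\<delta> \<equiv> curve_det \<gamma>1 \<gamma>2"

text \<open>Orthogonality to the u-derivatives of \<open>F\<close> and the normalisation against
  \<open>e_n\<close> give the entries -u and 1; the last entry is solved from orthogonality to the
  t-derivative.\<close>

definition conormal :: "real \<times> (real ^ 'm) \<Rightarrow> real ^ 'm option option" where
  "conormal p = coords (- snd p) 1 ((norm (snd p))\<^sup>2 / 2 - deriv \<gamma>2 (fst p) / g' (fst p))"

abbreviation form :: "real \<times> (real ^ 'm) \<Rightarrow> real \<times> (real ^ 'm) \<Rightarrow> real \<times> (real ^ 'm) \<Rightarrow> real" where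
  "form \<equiv> warped_metric (\<lambda>t. \<delta> t / g' t) \<gamma>1"

text \<open>The Christoffel symbols of the connection induced by \<open>e_n\<close>. A term in
  \<open>snd v \<bullet> snd w\<close> is absent because the second u-derivatives of
  \<open>F\<close> are multiples of \<open>e_n\<close>.\<close>

definition connection_form ::
  "real \<times> (real ^ 'm) \<Rightarrow> real \<times> (real ^ 'm) \<Rightarrow> real \<times> (real ^ 'm) \<Rightarrow> real \<times> (real ^ 'm)" where
  "connection_form p v w = (deriv g' (fst p) / g' (fst p) * (fst v * fst w),
     (g' (fst p) / \<gamma>1 (fst p)) *\<^sub>R (fst v *\<^sub>R snd w + fst w *\<^sub>R snd v))"

lemma nonzero: "t \<in> I \<Longrightarrow> \<gamma>1 t \<noteq> 0" "t \<in> I \<Longrightarrow> g' t \<noteq> 0" "t \<in> I \<Longrightarrow> \<delta> t \<noteq> 0"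
  using cond[of t] by auto

text \<open>Up to the square of \<open>g'\<close> this is the hypothesis on the curve: the two
  coefficients of \<open>form\<close> have the same sign.\<close>

lemma same_sign:
  assumes "t \<in> I"
  shows "\<gamma>1 t * (\<delta> t / g' t) > 0"
proof -
  have "\<gamma>1 t * (\<delta> t / g' t) = (g' t * \<gamma>1 t * \<delta> t) / (g' t)\<^sup>2"
    using nonzero(2)[OF assms] by (simp add: power2_eq_square)
  then show ?thesis
    using cond[OF assms] nonzero(2)[OF assms] by simp
qed

lemma open_\<Omega>: "open \<Omega>"
  using open_I open_U by (rule open_Times)

lemma smooth_deriv: "smooth_on I g'" "smooth_on I (deriv \<gamma>2)" "smooth_on I (deriv g')" "smooth_on I (deriv (deriv \<gamma>2))"
  by (intro smooth_on_deriv open_I sm1 sm2)+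

lemma smooth_\<delta>: "smooth_on I \<delta>"
  unfolding curve_det_def[abs_def]
  by (intro smooth_on_diff smooth_on_mult open_I smooth_deriv)

lemma smooth_fst: "smooth_on I \<gamma> \<Longrightarrow> smooth_on \<Omega> (\<lambda>q. \<gamma> (fst q))" for \<gamma> :: "real \<Rightarrow> real"
  using smooth_on_fst_fun[OF open_I open_U] .

lemma smooth_snd: "smooth_on \<Omega> snd"
  by (intro smooth_on_linear[OF bounded_linear_snd] open_\<Omega>)

text \<open>With the norm as an inner product and the halving as a multiplication, the rules for
  bilinear operations apply.\<close>

lemma F_eq: "F = (\<lambda>q. coords (\<gamma>1 (fst q) *\<^sub>R snd q) (\<gamma>1 (fst q) * ((snd q \<bullet> snd q) * (1 / 2)) + \<gamma>2 (fst q)) (\<gamma>1 (fst q)))"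
  by (auto simp: curve_hypersurface_def power2_norm_eq_inner)

lemma smooth_F: "smooth_on \<Omega> F"
  unfolding F_eq
  by (intro smooth_on_coords smooth_on_scaleR smooth_on_add smooth_on_mult smooth_on_inner smooth_fst
      smooth_snd sm1 sm2 open_\<Omega> smooth_on_const)

lemma smooth_conormal: "smooth_on \<Omega> conormal"
proof -
  have "conormal = (\<lambda>p. coords (- snd p) 1 ((snd p \<bullet> snd p) * (1 / 2) - deriv \<gamma>2 (fst p) / g' (fst p)))"
    by (auto simp: conormal_def power2_norm_eq_inner)
  then show ?thesis
    using nonzero
    by (auto intro!: smooth_on_coords smooth_on_minus smooth_on_diff smooth_on_mult smooth_on_inner
        smooth_on_divide smooth_fst smooth_snd smooth_deriv open_Times open_I open_U smooth_on_const)
qed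

lemma pushforward_F:
  assumes "p \<in> \<Omega>"
  shows "pushforward F p v = coords (fst v *\<^sub>R (g' (fst p) *\<^sub>R snd p) + \<gamma>1 (fst p) *\<^sub>R snd v)
    (fst v * (g' (fst p) * ((snd p \<bullet> snd p) / 2) + deriv \<gamma>2 (fst p)) + \<gamma>1 (fst p) * (snd p \<bullet> snd v))
    (fst v * g' (fst p))"
proof -
  have t: "fst p \<in> I"
    using assms by auto
  note D = has_derivative_fst_fun[OF _ t] has_derivative_snd[OF has_derivative_ident]
  have "(F has_derivative (\<lambda>v. coords (\<gamma>1 (fst p) *\<^sub>R snd v + (fst v * g' (fst p)) *\<^sub>R snd p)
     ((\<gamma>1 (fst p) * ((snd p \<bullet> snd v + snd v \<bullet> snd p) * (1 / 2)) + (fst v * g' (fst p)) * ((snd p \<bullet> snd p) * (1 / 2)))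
       + fst v * deriv \<gamma>2 (fst p))
     (fst v * g' (fst p)))) (at p)"
    unfolding F_eq
    by (intro has_derivative_coords has_derivative_add has_derivative_scaleR has_derivative_mult
        has_derivative_mult_left has_derivative_inner D sm1 sm2)
  then show ?thesis
    by (simp add: pushforward_eqI coords_eq_iff inner_commute algebra_simps)
qed

text \<open>Gauss formula for \<open>e_n\<close>. Its (t,t) part is \<open>F_tt\<close> =
  (\<gamma>1''/\<gamma>1') \<open>F_t\<close> + (\<delta>/\<gamma>1') \<open>e_n\<close>, and each
  mixed derivative is \<gamma>1'/\<gamma>1 times the corresponding u-derivative.\<close>

lemma second_derivative_F:
  assumes "p \<in> \<Omega>"
  shows "pushforward (\<lambda>q. pushforward F q w) p v
    = pushforward F p (connection_form p v w) + form p v w *\<^sub>R e_n"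
proof -
  have t: "fst p \<in> I"
    using assms by auto
  note D = has_derivative_fst_fun[OF _ t] has_derivative_snd[OF has_derivative_ident]
  have "((\<lambda>q. coords (fst w *\<^sub>R (g' (fst q) *\<^sub>R snd q) + \<gamma>1 (fst q) *\<^sub>R snd w)
    (fst w * (g' (fst q) * ((snd q \<bullet> snd q) * (1 / 2)) + deriv \<gamma>2 (fst q)) + \<gamma>1 (fst q) * (snd q \<bullet> snd w))
    (fst w * g' (fst q))) has_derivative
    (\<lambda>v. coords (fst w *\<^sub>R (g' (fst p) *\<^sub>R snd v + (fst v * deriv g' (fst p)) *\<^sub>R snd p) + (fst v * g' (fst p)) *\<^sub>R snd w)
      (fst w * ((g' (fst p) * ((snd p \<bullet> snd v + snd v \<bullet> snd p) * (1 / 2))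
            + (fst v * deriv g' (fst p)) * ((snd p \<bullet> snd p) * (1 / 2))) + fst v * deriv (deriv \<gamma>2) (fst p))
        + (\<gamma>1 (fst p) * (snd v \<bullet> snd w) + (fst v * g' (fst p)) * (snd p \<bullet> snd w)))
      (fst w * (fst v * deriv g' (fst p))))) (at p)" (is "(?f has_derivative ?d) _")
    by (intro has_derivative_coords has_derivative_add has_derivative_scaleR has_derivative_mult
        has_derivative_scaleR_right has_derivative_scaleR_left has_derivative_mult_right has_derivative_mult_left
        bounded_linear.has_derivative[OF bounded_linear_inner_left]
        has_derivative_inner D sm1 smooth_deriv)
  then have "pushforward (\<lambda>q. pushforward F q w) p v = ?d v"
    using pushforward_cong[OF open_\<Omega> assms, of "\<lambda>q. pushforward F q w" ?f]
    by (simp add: pushforward_F pushforward_eqI)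
  also have "\<dots> = pushforward F p (connection_form p v w) + form p v w *\<^sub>R e_n"
    using nonzero[OF t]
    by (simp add: pushforward_F[OF assms] connection_form_def warped_metric_def e_n_coords coords_scaleR
        coords_add coords_eq_iff curve_det_def inner_simps inner_commute field_simps)
  finally show ?thesis .
qed

lemma conormal_pushforward:
  assumes "p \<in> \<Omega>"
  shows "conormal p \<bullet> pushforward F p v = 0"
proof -
  have "g' (fst p) \<noteq> 0"
    using assms nonzero by auto
  then show ?thesis
    by (simp add: pushforward_F[OF assms] conormal_def inner_coords inner_simps inner_commute
        power2_norm_eq_inner field_simps)
qed

lemma conormal_e_n: "conormal p \<bullet> e_n = 1"
  by (simp add: conormal_def e_n_coords inner_coords)

lemma immersed: "immersed_hypersurface \<Omega> F"
  unfolding immersed_hypersurface_def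
proof (intro conjI ballI)
  fix p assume p: "p \<in> \<Omega>"
  then have nz: "g' (fst p) \<noteq> 0" "\<gamma>1 (fst p) \<noteq> 0"
    using nonzero by auto
  have L: "linear (pushforward F p)"
    using smooth_on_has_derivative[OF smooth_F p] has_derivative_linear by blast
  show "inj (pushforward F p)"
    unfolding linear_injective_0[OF L]
    using nz by (auto simp: pushforward_F[OF p] coords_0[symmetric] coords_eq_iff prod_eq_iff)
qed (simp_all add: open_\<Omega> smooth_F)

text \<open>The conormal has exactly the tangent space as kernel: writing \<open>e_n\<close> as a
  tangent vector plus a multiple a of x and pairing gives 1 = a
  \<open>(conormal p \<bullet> x)\<close>.\<close>

lemma transversal_iff:
  assumes "p \<in> \<Omega>"
  shows "x \<notin> range (pushforward F p) \<longleftrightarrow> conormal p \<bullet> x \<noteq> 0"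
proof
  assume x: "x \<notin> range (pushforward F p)"
  obtain v a where eq: "e_n = pushforward F p v + a *\<^sub>R x"
    using tangent_transversal_decomposition[OF immersed assms x] by blast
  have "conormal p \<bullet> e_n = a * (conormal p \<bullet> x)"
    unfolding eq by (simp add: inner_add_right conormal_pushforward[OF assms])
  then show "conormal p \<bullet> x \<noteq> 0"
    by (auto simp: conormal_e_n)
qed (use conormal_pushforward[OF assms] in auto)

lemma transversal_part_eq_conormal:
  assumes "p \<in> \<Omega>" "conormal p \<bullet> \<xi> p \<noteq> 0"
  shows "transversal_part F \<xi> p z = (conormal p \<bullet> z) / (conormal p \<bullet> \<xi> p)"
  using transversal_part_conormal[OF immersed assms(1), of \<xi> "conormal p" z] assms
  by (simp add: transversal_iff conormal_pushforward)

lemma affine_form_eq: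
  assumes "p \<in> \<Omega>" "conormal p \<bullet> \<xi> p \<noteq> 0"
  shows "affine_form F \<xi> p v w = form p v w / (conormal p \<bullet> \<xi> p)"
  by (simp add: affine_form_def second_derivative_F assms transversal_part_eq_conormal inner_add_right
      conormal_pushforward conormal_e_n)

text \<open>The two coefficients agree in sign but may both be negative; in that case the metric
  with negated coefficients is the positive one.\<close>

lemma form_definite:
  assumes "p \<in> \<Omega>"
  shows "definite (form p)"
proof -
  have t: "\<gamma>1 (fst p) * (\<delta> (fst p) / g' (fst p)) > 0"
    using assms same_sign by auto
  have "(\<lambda>v w. - form p v w) = warped_metric (\<lambda>t. - (\<delta> t / g' t)) (\<lambda>t. - \<gamma>1 t) p"
    by (simp add: fun_eq_iff warped_metric_def)
  then show ?thesis
    unfolding definite_def using t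
    by (auto simp only: zero_less_mult_iff intro!: positive_definite_warped_metric)
qed

lemma convex: "convex_hypersurface \<Omega> F"
  unfolding convex_hypersurface_def transversal_field_def
proof (intro conjI immersed exI[of _ "\<lambda>_. e_n"] ballI smooth_on_const)
  fix p assume p: "p \<in> \<Omega>"
  then show "e_n \<notin> range (pushforward F p)"
    by (simp add: transversal_iff conormal_e_n)
  have "affine_form F (\<lambda>_. e_n) p = form p"
    using affine_form_eq[OF p, of "\<lambda>_. e_n"] by (simp add: conormal_e_n fun_eq_iff)
  then show "definite (affine_form F (\<lambda>_. e_n) p)"
    using form_definite[OF p] by simp
qed

section \<open>Volume and Gram determinant of a frame\<close>

definition frame_matrix :: "('m option \<Rightarrow> real \<times> (real ^ 'm)) \<Rightarrow> real ^ 'm option ^ 'm option" where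
  "frame_matrix X = (\<chi> i j. case j of None \<Rightarrow> fst (X i) | Some j \<Rightarrow> snd (X i) $ j)"

text \<open>The matrix \<open>W\<close> of the volume is multiplied by the transpose of a matrix
  \<open>B\<close> of covectors that turns the tangent rows into scaled components of the frame. The
  minus sign is the determinant of \<open>B\<close>.\<close>

lemma induced_volume_eq:
  assumes p: "p \<in> \<Omega>"
  shows "induced_volume F \<xi> p X
    = - ((conormal p \<bullet> \<xi> p) * (g' (fst p) * \<gamma>1 (fst p) ^ CARD('m)) * det (frame_matrix X))"
proof -
  define W :: "real ^ 'm option option ^ 'm option option" where
    "W = (\<chi> k. case k of None \<Rightarrow> \<xi> p | Some i \<Rightarrow> pushforward F p (X i))"
  \<comment> \<open>Row \<open>None\<close> kills tangent vectors, row \<open>Some None\<close>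
    reads off \<open>g'\<close> times the t-component, and the other rows, corrected by -u_j in the
    last place, read off \<open>\<gamma>1\<close> times the u-components.\<close>
  define B :: "real ^ 'm option option ^ 'm option option" where
    "B = (\<chi> k. case k of None \<Rightarrow> conormal p | Some None \<Rightarrow> coords 0 0 1
      | Some (Some j) \<Rightarrow> coords (axis j 1) 0 (- snd p $ j))"
  \<comment> \<open>Exchanging these two rows moves the unit covector into row \<open>None\<close>,
    so that both block expansions apply and leave an identity matrix. The exchange accounts for the
    sign.\<close>
  let ?\<pi> = "Transposition.transpose None (Some None) :: 'm option option \<Rightarrow> _"
  define B' where "B' = (\<chi> k. B $ ?\<pi> k)"
  have "det B' = - det B"
    unfolding B'_def by (subst det_permute_rows) (simp_all add: permutes_swap_id sign_swap_id)
  moreover have "det B' = 1"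
  proof -
    have ax: "(if i = j then 1 else 0) = (if j = i then 1 else (0::real))" for i j :: 'm by simp
    have "det B' = det (\<chi> i j. B' $ Some i $ Some j)"
      by (subst det_option) (auto simp: B'_def B_def coords_0_0_Some)
    also have "\<dots> = det (\<chi> i j. B' $ Some (Some i) $ Some (Some j))"
      by (subst det_option_column) (auto simp: B'_def B_def conormal_def transpose_def)
    also have "(\<chi> i j. B' $ Some (Some i) $ Some (Some j)) = mat 1"
      by (simp add: B'_def B_def transpose_def mat_def axis_def vec_eq_iff ax)
    finally show ?thesis
      by simp
  qed
  ultimately have B: "det B = -1"
    by simp
  have nth: "(W ** transpose B) $ k $ l = W $ k \<bullet> B $ l" for k l
    by (simp add: matrix_matrix_mult_def inner_vec_def transpose_def)
  have "det W * det B = det (W ** transpose B)"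
    by (simp add: det_mul)
  also have "\<dots> = (\<xi> p \<bullet> conormal p) * det (\<chi> i j. (W ** transpose B) $ Some i $ Some j)"
    by (subst det_option_column) (simp_all only: nth, simp_all add: W_def B_def inner_commute conormal_pushforward[OF p])
  also have "(\<chi> i j. (W ** transpose B) $ Some i $ Some j)
      = (\<chi> i j. frame_matrix X $ i $ j * (case j of None \<Rightarrow> g' (fst p) | Some _ \<Rightarrow> \<gamma>1 (fst p)))"
    unfolding nth
    by (simp add: vec_eq_iff split_option_all W_def B_def frame_matrix_def pushforward_F[OF p] inner_coords
        inner_axis algebra_simps)
  also have "det \<dots> = det (frame_matrix X) * (g' (fst p) * \<gamma>1 (fst p) ^ CARD('m))"
    by (simp add: det_scale_columns prod_UNIV_option)
  finally have "det W = - ((conormal p \<bullet> \<xi> p) * (g' (fst p) * \<gamma>1 (fst p) ^ CARD('m)) * det (frame_matrix X))"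
    by (simp add: B inner_commute mult_ac)
  then show ?thesis
    by (simp only: induced_volume_def W_def)
qed

text \<open>The Gram matrix is M D M^T, with M the components of the frame and D the diagonal matrix
  of \<open>form\<close> divided by \<open>a\<close>.\<close>

lemma det_affine_form:
  assumes "p \<in> \<Omega>" and nz: "conormal p \<bullet> \<xi> p \<noteq> 0"
  defines "a \<equiv> conormal p \<bullet> \<xi> p"
  shows "det (\<chi> i j. affine_form F \<xi> p (X i) (X j))
    = (det (frame_matrix X))\<^sup>2 * (\<delta> (fst p) / (g' (fst p) * a) * (\<gamma>1 (fst p) / a) ^ CARD('m))"
proof -
  let ?d = "\<lambda>j. case j of None \<Rightarrow> \<delta> (fst p) / (g' (fst p) * a) | Some _ \<Rightarrow> \<gamma>1 (fst p) / a"
  have form: "affine_form F \<xi> p v w = form p v w / a" for v w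
    unfolding a_def using assms(1,2) by (rule affine_form_eq)
  have "(\<chi> i j. affine_form F \<xi> p (X i) (X j))
      = (\<chi> i j. frame_matrix X $ i $ j * ?d j) ** transpose (frame_matrix X)"
    by (simp add: vec_eq_iff form matrix_matrix_mult_def
        sum_UNIV_option transpose_def frame_matrix_def warped_metric_def inner_vec_def sum_distrib_left
        sum_divide_distrib add_divide_distrib mult_ac)
  then show ?thesis
    by (simp add: det_mul det_scale_columns prod_UNIV_option power2_eq_square mult_ac)
qed

end

text \<open>Used with a = \<open>conormal p \<bullet> \<xi> p\<close>, c = \<gamma>1', g =
  \<gamma>1, d = \<delta> and m = n - 1. Clearing denominators adds the degrees: 2 + 1 + m = n + 2
  in a, 2 + 1 in c, and 2m - m in g.\<close>

lemma volume_equation_iff: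
  fixes a c g d :: real
  assumes "a \<noteq> 0" "c \<noteq> 0" "g \<noteq> 0"
  shows "(a * (c * g ^ m))\<^sup>2 = \<bar>d / (c * a) * (g / a) ^ m\<bar> \<longleftrightarrow> \<bar>a\<bar> ^ (m + 3) * \<bar>c\<bar> ^ 3 * \<bar>g\<bar> ^ m = \<bar>d\<bar>"
proof -
  have *: "(A * (C * G))\<^sup>2 = D / (C * A) * (G / B) \<longleftrightarrow> B * A ^ 3 * C ^ 3 * G = D"
    if "A > 0" "B > 0" "C > 0" "G > 0" for A B C D G :: real
  proof -
    have "(A * (C * G))\<^sup>2 = D / (C * A) * (G / B) \<longleftrightarrow> (B * A ^ 3 * C ^ 3 * G) * G = D * G"
      using that by (simp add: field_simps power2_eq_square power3_eq_cube)
    then show ?thesis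
      using that by simp
  qed
  have sq: "(a * (c * g ^ m))\<^sup>2 = (\<bar>a\<bar> * (\<bar>c\<bar> * \<bar>g\<bar> ^ m))\<^sup>2"
    by (simp add: power_mult_distrib power_abs[symmetric])
  have abs: "\<bar>d / (c * a) * (g / a) ^ m\<bar> = \<bar>d\<bar> / (\<bar>c\<bar> * \<bar>a\<bar>) * (\<bar>g\<bar> ^ m / \<bar>a\<bar> ^ m)"
    by (simp add: abs_mult power_abs power_divide)
  show ?thesis
    unfolding sq abs power_add by (rule *) (use assms in auto)
qed

section \<open>The affine normal\<close>

lemma definite_eq_0: "definite h \<Longrightarrow> h v v = 0 \<Longrightarrow> v = 0"
  unfolding definite_def positive_definite_def by (metis less_irrefl minus_zero)

text \<open>\<open>\<mu>_sign\<close> makes \<open>form\<close> divided by \<open>\<mu>\<close>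
  positive definite; \<open>\<mu>_power\<close> is the volume condition, in absolute values so that
  the sign \<open>\<sigma>\<close> does not enter. The exponents n + 2 and n - 1 appear as
  \<open>CARD('m) + 3\<close> and \<open>CARD('m)\<close>.\<close>

locale curve_normal = curve_data I U \<gamma>1 \<gamma>2
  for I and U :: "(real ^ 'm::finite) set" and \<gamma>1 \<gamma>2 +
  fixes \<mu> :: "real \<Rightarrow> real"
  assumes smooth_\<mu>: "smooth_on I \<mu>" and \<mu>_sign: "t \<in> I \<Longrightarrow> \<gamma>1 t * \<mu> t > 0"
    and \<mu>_power: "t \<in> I \<Longrightarrow> \<bar>\<mu> t\<bar> ^ (CARD('m) + 3) * \<bar>g' t\<bar> ^ 3 * \<bar>\<gamma>1 t\<bar> ^ CARD('m) = \<bar>\<delta> t\<bar>"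
begin

definition \<nu> :: "real \<Rightarrow> real" where
  "\<nu> t = - deriv \<mu> t * g' t / \<delta> t"

abbreviation "F_t p \<equiv> pushforward F p (1, 0)"

definition normal :: "real \<times> (real ^ 'm) \<Rightarrow> real ^ 'm option option" where
  "normal p = \<mu> (fst p) *\<^sub>R e_n + \<nu> (fst p) *\<^sub>R F_t p"

definition dt2 :: "real \<Rightarrow> real" where "dt2 t = \<delta> t / g' t / \<mu> t"
definition du2 :: "real \<Rightarrow> real" where "du2 t = \<gamma>1 t / \<mu> t"

lemma \<mu>_nonzero: "t \<in> I \<Longrightarrow> \<mu> t \<noteq> 0"
  using \<mu>_sign by force

lemma smooth_\<nu>: "smooth_on I \<nu>"
  unfolding \<nu>_def[abs_def] using nonzero
  by (intro smooth_on_divide smooth_on_mult smooth_on_minus smooth_on_deriv smooth_\<mu> smooth_\<delta> smooth_deriv open_I) auto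

lemma smooth_dt2: "smooth_on I dt2" and smooth_du2: "smooth_on I du2"
  unfolding dt2_def[abs_def] du2_def[abs_def] using nonzero \<mu>_nonzero
  by (intro smooth_on_divide smooth_\<mu> smooth_\<delta> smooth_deriv sm1 open_I; auto)+

lemma metric_coefficients_pos:
  assumes "t \<in> I"
  shows "dt2 t > 0" "du2 t > 0"
proof -
  have "dt2 t = (\<gamma>1 t * (\<delta> t / g' t)) / (\<gamma>1 t * \<mu> t)" "du2 t = (\<gamma>1 t * \<mu> t) / (\<mu> t)\<^sup>2"
    using nonzero[OF assms] \<mu>_nonzero[OF assms] by (simp_all add: dt2_def du2_def power2_eq_square)
  then show "dt2 t > 0" "du2 t > 0"
    using same_sign[OF assms] \<mu>_sign[OF assms] \<mu>_nonzero[OF assms]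
    by (simp_all only: divide_pos_pos zero_less_power2 not_False_eq_True)
qed

lemma form_div_\<mu>: "form p v w / \<mu> (fst p) = warped_metric dt2 du2 p v w"
  by (simp add: warped_metric_def dt2_def du2_def add_divide_distrib)

lemma \<nu>_equation: "t \<in> I \<Longrightarrow> deriv \<mu> t = - \<nu> t * (\<delta> t / g' t)"
  using nonzero by (simp add: \<nu>_def)

text \<open>Positive definiteness settles the sign that the volume condition leaves open, and
  \<open>\<mu>_sign\<close> makes the resulting value \<open>\<mu>\<close>. The tangential component
  of \<open>\<xi>\<close> is constrained only through its derivative.\<close>

lemma convex_affine_normal_iff:
  "convex_affine_normal \<Omega> F \<xi> \<longleftrightarrow> smooth_on \<Omega> \<xi> \<and>
    (\<forall>p\<in>\<Omega>. conormal p \<bullet> \<xi> p = \<mu> (fst p) \<and> (\<forall>v. conormal p \<bullet> pushforward \<xi> p v = 0))"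
proof
  assume R: "smooth_on \<Omega> \<xi> \<and>
    (\<forall>p\<in>\<Omega>. conormal p \<bullet> \<xi> p = \<mu> (fst p) \<and> (\<forall>v. conormal p \<bullet> pushforward \<xi> p v = 0))"
  then have nz: "conormal p \<bullet> \<xi> p \<noteq> 0" if "p \<in> \<Omega>" for p
    using that \<mu>_nonzero by auto
  have tr: "transversal_field \<Omega> F \<xi>"
    using R nz by (simp add: transversal_field_def transversal_iff)
  have form: "affine_form F \<xi> p = warped_metric dt2 du2 p" if "p \<in> \<Omega>" for p
  proof (rule ext)+
    show "affine_form F \<xi> p v w = warped_metric dt2 du2 p v w" for v w
      using R that form_div_\<mu>[of p v w] by (simp only: affine_form_eq[of p \<xi>, OF that nz[OF that]])
  qed
  have pos: "positive_definite (affine_form F \<xi> p)" if "p \<in> \<Omega>" for p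
    unfolding form[OF that] using that metric_coefficients_pos
    by (intro positive_definite_warped_metric) auto
  have "nondegenerate (affine_form F \<xi> p)" if "p \<in> \<Omega>" for p
    using pos[OF that] unfolding nondegenerate_def positive_definite_def by (metis less_irrefl)
  moreover have "parallel_volume \<Omega> F \<xi>"
    unfolding parallel_volume_iff[OF immersed tr]
    using R nz by (simp add: transversal_part_eq_conormal)
  moreover have "(induced_volume F \<xi> p X)\<^sup>2 = \<bar>det (\<chi> i j. affine_form F \<xi> p (X i) (X j))\<bar>"
    if p: "p \<in> \<Omega>" for p and X :: "'m option \<Rightarrow> real \<times> (real ^ 'm)"
  proof -
    let ?a = "conormal p \<bullet> \<xi> p" and ?t = "fst p"
    have t: "?t \<in> I" and a: "?a = \<mu> ?t"
      using p R by auto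
    \<comment> \<open>Both sides of the volume condition carry the factor
      \<open>(det (frame_matrix X))\<^sup>2\<close>, so one scalar equation settles it for every
      frame.\<close>
    have "(?a * (g' ?t * \<gamma>1 ?t ^ CARD('m)))\<^sup>2 = \<bar>\<delta> ?t / (g' ?t * ?a) * (\<gamma>1 ?t / ?a) ^ CARD('m)\<bar>"
      unfolding a volume_equation_iff[OF \<mu>_nonzero[OF t] nonzero(2,1)[OF t]] by (rule \<mu>_power[OF t])
    then show ?thesis
      unfolding induced_volume_eq[OF p] det_affine_form[of p \<xi>, OF p nz[OF p]]
      by (simp add: power_mult_distrib abs_mult)
  qed
  ultimately show "convex_affine_normal \<Omega> F \<xi>"
    using tr pos by (simp add: convex_affine_normal_def affine_normal_def)
next
  assume L: "convex_affine_normal \<Omega> F \<xi>"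
  then have tr: "transversal_field \<Omega> F \<xi>"
    and pos: "\<And>p. p \<in> \<Omega> \<Longrightarrow> positive_definite (affine_form F \<xi> p)"
    and par: "parallel_volume \<Omega> F \<xi>"
    and vol: "\<And>p X. p \<in> \<Omega> \<Longrightarrow> inj X \<Longrightarrow> independent (range X) \<Longrightarrow>
        (induced_volume F \<xi> p X)\<^sup>2 = \<bar>det (\<chi> i j. affine_form F \<xi> p (X i) (X j))\<bar>"
    unfolding convex_affine_normal_def affine_normal_def by blast+
  have nz: "conormal p \<bullet> \<xi> p \<noteq> 0" if "p \<in> \<Omega>" for p
    using tr that transversal_iff[OF that, of "\<xi> p"] unfolding transversal_field_def by blast
  \<comment> \<open>The coordinate frame: its \<open>frame_matrix\<close> is the identity, so its
    volume condition is the scalar equation itself.\<close>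
  define E :: "'m option \<Rightarrow> real \<times> (real ^ 'm)" where
    "E k = (case k of None \<Rightarrow> (1, 0) | Some i \<Rightarrow> (0, axis i 1))" for k
  have "inj E"
    by (auto simp: inj_def E_def axis_eq_axis split: option.splits)
  moreover have "range E \<subseteq> Basis"
    by (auto simp: E_def Basis_prod_def axis_in_Basis_iff split: option.splits)
  then have "independent (range E)"
    using independent_mono[OF independent_Basis] by blast
  moreover have E: "det (frame_matrix E) = 1"
  proof -
    have "frame_matrix E = mat 1"
      by (auto simp: frame_matrix_def E_def mat_def axis_def vec_eq_iff split_option_all)
    then show ?thesis by simp
  qed
  ultimately have volE: "(induced_volume F \<xi> p E)\<^sup>2 = \<bar>det (\<chi> i j. affine_form F \<xi> p (E i) (E j))\<bar>"
    if "p \<in> \<Omega>" for p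
    using vol[OF that] by blast
  have "conormal p \<bullet> \<xi> p = \<mu> (fst p)" if p: "p \<in> \<Omega>" for p
  proof -
    let ?a = "conormal p \<bullet> \<xi> p" and ?t = "fst p"
    have t: "?t \<in> I"
      using p by auto
    note nzt = nonzero[OF t]
    have "(?a * (g' ?t * \<gamma>1 ?t ^ CARD('m)))\<^sup>2 = \<bar>\<delta> ?t / (g' ?t * ?a) * (\<gamma>1 ?t / ?a) ^ CARD('m)\<bar>"
      using volE[OF p] unfolding induced_volume_eq[OF p] det_affine_form[of p \<xi>, OF p nz[OF p]]
      by (simp add: E)
    then have "\<bar>?a\<bar> ^ (CARD('m) + 3) * \<bar>g' ?t\<bar> ^ 3 * \<bar>\<gamma>1 ?t\<bar> ^ CARD('m) = \<bar>\<delta> ?t\<bar>"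
      unfolding volume_equation_iff[OF nz[OF p] nzt(2,1)] .
    then have "\<bar>?a\<bar> ^ (CARD('m) + 3) = \<bar>\<mu> ?t\<bar> ^ (CARD('m) + 3)"
      unfolding \<mu>_power[OF t, symmetric] using nzt by simp
    then have abs: "\<bar>?a\<bar> = \<bar>\<mu> ?t\<bar>"
      by (subst (asm) power_eq_iff_eq_base) auto
    \<comment> \<open>The dt^2 coefficient decides the sign: \<delta>/\<gamma>1' has the sign of
      \<open>\<gamma>1\<close>, hence that of \<open>\<mu>\<close>.\<close>
    have "affine_form F \<xi> p (1, 0) (1, 0) > 0"
      using pos[OF p] by (simp add: positive_definite_def zero_prod_def)
    then have "\<delta> ?t / g' ?t / ?a > 0"
      by (simp add: affine_form_eq[of p \<xi>, OF p nz[OF p]] warped_metric_def)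
    moreover have "a * m > 0" if "x * q > 0" "x * m > 0" "q / a > 0" for x q m a :: real
      using that by (auto simp: zero_less_mult_iff zero_less_divide_iff)
    ultimately have "?a * \<mu> ?t > 0"
      using same_sign[OF t] \<mu>_sign[OF t] by blast
    then show ?thesis
      using abs by (auto simp: abs_if zero_less_mult_iff split: if_splits)
  qed
  moreover have "conormal p \<bullet> pushforward \<xi> p v = 0" if "p \<in> \<Omega>" for p v
  proof -
    have "transversal_part F \<xi> p (pushforward \<xi> p v) = 0"
      using par that unfolding parallel_volume_iff[OF immersed tr] by blast
    then show ?thesis
      using nz[OF that] by (simp add: transversal_part_eq_conormal[of p \<xi>, OF that nz[OF that]])
  qed
  ultimately show "smooth_on \<Omega> \<xi> \<and>
    (\<forall>p\<in>\<Omega>. conormal p \<bullet> \<xi> p = \<mu> (fst p) \<and> (\<forall>v. conormal p \<bullet> pushforward \<xi> p v = 0))"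
    using tr by (simp add: transversal_field_def)
qed

lemma smooth_normal: "smooth_on \<Omega> normal"
  unfolding normal_def[abs_def]
  by (intro smooth_on_add smooth_on_scaleR smooth_fst smooth_\<mu> smooth_\<nu> smooth_on_const open_\<Omega>
      smooth_on_pushforward smooth_F)

lemma conormal_normal: "p \<in> \<Omega> \<Longrightarrow> conormal p \<bullet> normal p = \<mu> (fst p)"
  by (simp add: normal_def inner_add_right conormal_e_n conormal_pushforward)

lemma pushforward_F_linear: "p \<in> \<Omega> \<Longrightarrow> linear (pushforward F p)"
  by (rule pushforward_linear[OF immersed])

text \<open>The \<open>e_n\<close>-part of the derivative is \<open>fst v\<close> times
  \<open>\<mu>' + \<nu> * (\<delta> / g')\<close>, with the prime on \<open>\<mu>\<close> for its
  derivative; \<open>\<nu>\<close> is chosen to make it vanish. Up to sign, the remaining tangent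
  vector is the shape operator.\<close>

lemma pushforward_normal:
  assumes p: "p \<in> \<Omega>"
  shows "pushforward normal p v
    = pushforward F p ((fst v * deriv \<nu> (fst p)) *\<^sub>R (1, 0) + \<nu> (fst p) *\<^sub>R connection_form p v (1, 0))"
proof -
  have t: "fst p \<in> I"
    using p by auto
  note L = pushforward_F_linear[OF p]
  have "(normal has_derivative (\<lambda>v. (fst v * deriv \<mu> (fst p)) *\<^sub>R e_n
    + (\<nu> (fst p) *\<^sub>R pushforward F_t p v + (fst v * deriv \<nu> (fst p)) *\<^sub>R F_t p))) (at p)"
    unfolding normal_def[abs_def]
    by (intro has_derivative_add has_derivative_scaleR has_derivative_scaleR_left has_derivative_fst_fun[OF _ t]
        smooth_\<mu> smooth_\<nu> smooth_on_has_derivative[OF smooth_on_pushforward[OF smooth_F] p])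
  then have "pushforward normal p v = (fst v * deriv \<mu> (fst p)) *\<^sub>R e_n
    + (\<nu> (fst p) *\<^sub>R pushforward F_t p v + (fst v * deriv \<nu> (fst p)) *\<^sub>R F_t p)"
    by (simp add: pushforward_eqI)
  also have "\<dots> = \<nu> (fst p) *\<^sub>R pushforward F p (connection_form p v (1, 0)) + (fst v * deriv \<nu> (fst p)) *\<^sub>R F_t p
     + (fst v * (deriv \<mu> (fst p) + \<nu> (fst p) * (\<delta> (fst p) / g' (fst p)))) *\<^sub>R e_n"
    by (simp add: second_derivative_F[OF p] warped_metric_def algebra_simps)
  also have "deriv \<mu> (fst p) + \<nu> (fst p) * (\<delta> (fst p) / g' (fst p)) = 0"
    by (simp add: \<nu>_equation[OF t])
  finally show ?thesis
    by (simp only: linear_add[OF L] linear_cmul[OF L] mult_zero_right scaleR_zero_left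
        add_0_left add_0_right add.commute)
qed

lemma convex_affine_normal_normal: "convex_affine_normal \<Omega> F normal"
  unfolding convex_affine_normal_iff
  by (simp add: smooth_normal conormal_normal pushforward_normal conormal_pushforward)

lemma convex_affine_normal_unique:
  "convex_affine_normal \<Omega> F \<xi> \<longleftrightarrow> (\<forall>p\<in>\<Omega>. \<xi> p = normal p)"
proof
  assume eq: "\<forall>p\<in>\<Omega>. \<xi> p = normal p"
  have "pushforward \<xi> p = pushforward normal p" if "p \<in> \<Omega>" for p
    using eq by (intro pushforward_cong[OF open_\<Omega> that]) auto
  moreover have "smooth_on \<Omega> \<xi>"
    using eq smooth_on_cong[OF open_\<Omega>, of \<xi> normal] smooth_normal by auto
  ultimately show "convex_affine_normal \<Omega> F \<xi>"
    using eq convex_affine_normal_normal unfolding convex_affine_normal_iff by auto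
next
  assume "convex_affine_normal \<Omega> F \<xi>"
  then have sm: "smooth_on \<Omega> \<xi>"
    and con: "\<And>p. p \<in> \<Omega> \<Longrightarrow> conormal p \<bullet> \<xi> p = \<mu> (fst p)"
    and D\<xi>: "\<And>p v. p \<in> \<Omega> \<Longrightarrow> conormal p \<bullet> pushforward \<xi> p v = 0"
    by (auto simp: convex_affine_normal_iff)
  show "\<forall>p\<in>\<Omega>. \<xi> p = normal p"
  proof
    fix p assume p: "p \<in> \<Omega>"
    have "e_n \<notin> range (pushforward F p)"
      by (simp add: transversal_iff[OF p] conormal_e_n)
    then obtain Z b where Zb: "\<xi> p - normal p = pushforward F p Z + b *\<^sub>R e_n"
      using tangent_transversal_decomposition[OF immersed p] by blast
    have "conormal p \<bullet> (\<xi> p - normal p) = b"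
      unfolding Zb by (simp add: inner_add_right conormal_pushforward[OF p] conormal_e_n)
    then have "b = 0"
      by (simp add: inner_diff_right con[OF p] conormal_normal[OF p])
    note D = smooth_on_has_derivative[OF _ p]
    \<comment> \<open>Trades a derivative of \<open>\<eta>\<close> for one of the conormal. It is
      applied to the difference of the two fields and to the tangent field generated by Z, frozen as
      a constant field.\<close>
    have product_zero: "conormal p \<bullet> \<eta>' v + pushforward conormal p v \<bullet> \<eta> p = 0"
      if "(\<eta> has_derivative \<eta>') (at p)" "\<And>q. q \<in> \<Omega> \<Longrightarrow> conormal q \<bullet> \<eta> q = 0" for \<eta> \<eta>' v
    proof -
      have "(\<lambda>v. conormal p \<bullet> \<eta>' v + pushforward conormal p v \<bullet> \<eta> p) = pushforward (\<lambda>q. conormal q \<bullet> \<eta> q) p"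
        by (rule pushforward_eqI[OF has_derivative_inner[OF D[OF smooth_conormal] that(1)], symmetric])
      also have "\<dots> = (\<lambda>v. 0)"
        using pushforward_cong[OF open_\<Omega> p that(2)] by simp
      finally show ?thesis
        by (rule fun_cong)
    qed
    have "pushforward conormal p v \<bullet> (\<xi> p - normal p) = 0" for v
    proof -
      have "conormal q \<bullet> (\<xi> q - normal q) = 0" if "q \<in> \<Omega>" for q
        by (simp add: inner_diff_right con[OF that] conormal_normal[OF that])
      from product_zero[OF has_derivative_diff[OF D[OF sm] D[OF smooth_normal]] this, of v]
      show ?thesis
        by (simp add: inner_diff_right D\<xi>[OF p] pushforward_normal[OF p] conormal_pushforward[OF p])
    qed
    moreover have "form p v Z + pushforward conormal p v \<bullet> pushforward F p Z = 0" for v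
      using product_zero[OF D[OF smooth_on_pushforward[OF smooth_F]] conormal_pushforward, of Z v]
      by (simp add: second_derivative_F[OF p] inner_add_right conormal_pushforward[OF p] conormal_e_n)
    \<comment> \<open>At p the two fields differ by \<open>pushforward F p Z\<close>, so both
      identities contain the same pairing; take v = Z.\<close>
    ultimately have "form p Z Z = 0"
      using Zb \<open>b = 0\<close> by simp
    then have "Z = 0"
      using definite_eq_0[OF form_definite[OF p]] by blast
    then show "\<xi> p = normal p"
      using Zb \<open>b = 0\<close> linear_0[OF pushforward_F_linear[OF p]] by simp
  qed
qed

lemma normal_transversal: "p \<in> \<Omega> \<Longrightarrow> normal p \<notin> range (pushforward F p)"
  by (simp add: transversal_iff conormal_normal) (auto simp: \<mu>_nonzero)

lemma affine_form_normal: "p \<in> \<Omega> \<Longrightarrow> affine_form F normal p = warped_metric dt2 du2 p"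
proof (rule ext)+
  fix v w assume p: "p \<in> \<Omega>"
  then have "conormal p \<bullet> normal p \<noteq> 0"
    using \<mu>_nonzero by (auto simp: conormal_normal)
  then show "affine_form F normal p v w = warped_metric dt2 du2 p v w"
    using affine_form_eq[of p normal, OF p] by (simp add: conormal_normal[OF p] form_div_\<mu>)
qed

section \<open>Shape operator, difference tensor and pointwise symmetry\<close>

lemma shape_operator_normal:
  assumes p: "p \<in> \<Omega>"
  shows "\<exists>a b. \<forall>v. shape_operator F normal p v = (a * fst v, b *\<^sub>R snd v)"
proof -
  have "shape_operator F normal p v
      = - ((fst v * deriv \<nu> (fst p)) *\<^sub>R (1, 0) + \<nu> (fst p) *\<^sub>R connection_form p v (1, 0))" for v
    using tangential_part_eq[of \<Omega> F p normal _ 0, OF immersed p normal_transversal[OF p]]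
    by (simp add: shape_operator_def pushforward_normal[OF p])
  then have "shape_operator F normal p v = (- (deriv \<nu> (fst p) + \<nu> (fst p) * (deriv g' (fst p) / g' (fst p))) * fst v,
      (- (\<nu> (fst p) * (g' (fst p) / \<gamma>1 (fst p)))) *\<^sub>R snd v)" for v
    by (simp add: connection_form_def algebra_simps)
  then show ?thesis
    by blast
qed

text \<open>Substituting \<open>e_n\<close> = (\<open>normal\<close> - \<open>\<nu>\<close>
  \<open>F_t\<close>) / \<open>\<mu>\<close> into the Gauss formula for \<open>e_n\<close> moves a
  multiple of \<open>F_t\<close> into the tangential part.\<close>

lemma induced_connection_normal:
  assumes p: "p \<in> \<Omega>"
  shows "induced_connection F normal p v (\<lambda>_. w)
    = connection_form p v w - (form p v w * \<nu> (fst p) / \<mu> (fst p)) *\<^sub>R (1, 0)"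
proof -
  note L = pushforward_F_linear[OF p]
  have "\<mu> (fst p) \<noteq> 0"
    using p \<mu>_nonzero by auto
  then have "pushforward (\<lambda>q. pushforward F q w) p v
    = pushforward F p (connection_form p v w - (form p v w * \<nu> (fst p) / \<mu> (fst p)) *\<^sub>R (1, 0))
      + (form p v w / \<mu> (fst p)) *\<^sub>R normal p"
    using linear_cmul[OF L, of "form p v w * \<nu> (fst p) / \<mu> (fst p)" "(1, 0)"]
    by (simp add: second_derivative_F[OF p] normal_def linear_diff[OF L] scaleR_add_right)
  then show ?thesis
    using tangential_part_eq[of \<Omega> F p normal, OF immersed p normal_transversal[OF p]]
    by (simp add: induced_connection_def)
qed

text \<open>Both connections are combinations of the same three expressions in v and w. The
  existential form keeps exactly this shape, from which the symmetry follows.\<close>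

lemma difference_tensor_normal:
  assumes p: "p \<in> \<Omega>"
  shows "\<exists>a b c. \<forall>v w. difference_tensor \<Omega> F normal p v w
    = (a * (fst v * fst w) + b * (snd v \<bullet> snd w), c *\<^sub>R (fst v *\<^sub>R snd w + fst w *\<^sub>R snd v))"
proof -
  have "levi_civita \<Omega> (affine_form F normal) p v (\<lambda>_. w) = warped_christoffel dt2 du2 p v w" for v w
    using metric_coefficients_pos
    by (intro levi_civita_warped[OF open_I open_U smooth_dt2 smooth_du2 _ affine_form_normal p]) auto
  then have "difference_tensor \<Omega> F normal p v w
    = ((deriv g' (fst p) / g' (fst p) - \<delta> (fst p) / g' (fst p) * \<nu> (fst p) / \<mu> (fst p)
          - deriv dt2 (fst p) / (2 * dt2 (fst p))) * (fst v * fst w)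
        + (deriv du2 (fst p) / (2 * dt2 (fst p)) - \<gamma>1 (fst p) * \<nu> (fst p) / \<mu> (fst p)) * (snd v \<bullet> snd w),
       (g' (fst p) / \<gamma>1 (fst p) - deriv du2 (fst p) / (2 * du2 (fst p))) *\<^sub>R (fst v *\<^sub>R snd w + fst w *\<^sub>R snd v))" for v w
    by (simp add: difference_tensor_def induced_connection_normal[OF p] connection_form_def
        warped_christoffel_def warped_metric_def prod_eq_iff algebra_simps add_divide_distrib)
  then show ?thesis
    by blast
qed

text \<open>An admissible g fixes the t-direction and acts on the fibre by a linear map that
  preserves the Euclidean inner product. The expressions for S and K, built from t-components, fibre
  components and that inner product, commute with it.\<close>

lemma symmetry: "pointwise_SO_symmetry \<Omega> F"
  unfolding pointwise_SO_symmetry_def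
proof (intro exI[of _ normal] conjI convex_affine_normal_normal ballI)
  fix p assume p: "p \<in> \<Omega>"
  then have pos: "dt2 (fst p) > 0" "du2 (fst p) > 0"
    using metric_coefficients_pos by auto
  \<comment> \<open>The t-direction scaled to unit length; the affine metric is diagonal, so its
    orthogonal complement is the fibre.\<close>
  let ?X = "(1 / sqrt (dt2 (fst p)), 0) :: real \<times> (real ^ 'm)"
  let ?h = "affine_form F normal p"
  note h = affine_form_normal[OF p]
  obtain a b where S: "\<And>v. shape_operator F normal p v = (a * fst v, b *\<^sub>R snd v)"
    using shape_operator_normal[OF p] by blast
  obtain c d e where K: "\<And>v w. difference_tensor \<Omega> F normal p v w
    = (c * (fst v * fst w) + d * (snd v \<bullet> snd w), e *\<^sub>R (fst v *\<^sub>R snd w + fst w *\<^sub>R snd v))"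
    using difference_tensor_normal[OF p] by blast
  have perp: "{x. ?h ?X x = 0} = {x. fst x = 0}"
    using pos by (auto simp: h warped_metric_def)
  show "\<exists>X1. ?h X1 X1 = 1 \<and>
         (\<forall>g. linear g \<and> bij g \<and> g X1 = X1 \<and> restricts_to_SO ?h {x. ?h X1 x = 0} g \<longrightarrow>
            (\<forall>x. shape_operator F normal p (g x) = g (shape_operator F normal p x)) \<and>
            (\<forall>x y. difference_tensor \<Omega> F normal p (g x) (g y) = g (difference_tensor \<Omega> F normal p x y)))"
  proof (intro exI[of _ ?X] conjI allI impI; (elim conjE)?)
    show "?h ?X ?X = 1"
      using pos by (simp add: h warped_metric_def field_simps)
  next
    fix g :: "real \<times> (real ^ 'm) \<Rightarrow> real \<times> (real ^ 'm)"
    assume lin: "linear g" and gX: "g ?X = ?X" and SO: "restricts_to_SO ?h {x. ?h ?X x = 0} g"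
    define G where "G x = snd (g (0, x))" for x
    have "g (1, 0) = g (sqrt (dt2 (fst p)) *\<^sub>R ?X)"
      using pos by simp
    also have "\<dots> = (1, 0)"
      unfolding linear_cmul[OF lin] gX using pos by simp
    finally have g1: "g (1, 0) = (1, 0)" .
    have "fst (g (0, x)) = 0" for x
      using SO unfolding restricts_to_SO_def perp by (auto simp: image_subset_iff)
    then have g0: "g (0, x) = (0, G x)" for x
      by (simp add: G_def prod_eq_iff)
    have g: "g v = (fst v, G (snd v))" for v
    proof -
      have "g v = g (fst v *\<^sub>R (1, 0) + (0, snd v))"
        by simp
      then show ?thesis
        by (simp only: linear_add[OF lin] linear_cmul[OF lin] g1 g0) simp
    qed
    \<comment> \<open>On the fibre the affine metric is \<open>du2\<close> times the Euclidean inner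
      product.\<close>
    have G_inner: "G x \<bullet> G y = x \<bullet> y" for x y
    proof -
      have "?h (g (0, x)) (g (0, y)) = ?h (0, x) (0, y)"
        using SO unfolding restricts_to_SO_def perp by simp
      then show ?thesis
        using pos by (simp add: h g0 warped_metric_def)
    qed
    have G_lin: "G (x + y) = G x + G y" "G (c *\<^sub>R x) = c *\<^sub>R G x" for x y c
      using linear_add[OF lin, of "(0, x)" "(0, y)"] linear_cmul[OF lin, of c "(0, x)"] by (simp_all add: G_def)
    show "shape_operator F normal p (g x) = g (shape_operator F normal p x)" for x
      by (simp add: S g G_lin)
    show "difference_tensor \<Omega> F normal p (g x) (g y) = g (difference_tensor \<Omega> F normal p x y)" for x y
      by (simp add: K g G_lin G_inner)
  qed
qed

text \<open>Links the partial derivative in the theorem with the coordinate field used in the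
  computations.\<close>

lemma vector_derivative_F:
  assumes "t \<in> I" "u \<in> U"
  shows "vector_derivative (\<lambda>s. F (s, u)) (at t) = F_t (t, u)"
proof (rule vector_derivative_at)
  have p: "(t, u) \<in> \<Omega>"
    using assms by simp
  have "((\<lambda>s. F (s, u)) has_derivative (\<lambda>r. pushforward F (t, u) (r, 0))) (at t)"
    using has_derivative_compose[of "\<lambda>s. (s, u)" "\<lambda>r. (r, 0)" t UNIV F "pushforward F (t, u)"]
      has_derivative_Pair[OF has_derivative_ident has_derivative_const] smooth_on_has_derivative[OF smooth_F p]
    by blast
  then show "((\<lambda>s. F (s, u)) has_vector_derivative F_t (t, u)) (at t)"
    unfolding has_vector_derivative_def using linear_cmul[OF pushforward_F_linear[OF p], of _ "(1, 0)", symmetric] by simp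
qed

end

section \<open>Existence and uniqueness of the scale \<open>\<mu>\<close>\<close>

context curve_data
begin

text \<open>The power equation prescribes \<mu>^(n+2) as \<open>\<kappa>\<close> up to sign. So
  \<open>\<mu>\<close> is the positive (n+2)-nd root of the absolute value of
  \<open>\<kappa>\<close>, multiplied by the sign \<open>e1\<close> of \<open>\<gamma>1\<close>;
  \<open>e2\<close> is the sign of \<open>\<kappa>\<close>.\<close>

lemma exists_normal_scale:
  obtains \<mu> \<sigma> where "curve_normal I U \<gamma>1 \<gamma>2 \<mu>" "\<sigma> \<in> {1, -1}"
    "\<And>t. t \<in> I \<Longrightarrow> \<mu> t ^ (CARD('m) + 3) * g' t ^ 3 * \<gamma>1 t ^ CARD('m) = \<sigma> * \<delta> t"
proof -
  let ?k = "CARD('m) + 3"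
  define \<kappa> where "\<kappa> t = \<delta> t / (g' t ^ 3 * \<gamma>1 t ^ CARD('m))" for t
  have smooth_\<kappa>: "smooth_on I \<kappa>"
    unfolding \<kappa>_def[abs_def] using nonzero
    by (intro smooth_on_divide smooth_on_mult smooth_on_power smooth_\<delta> smooth_deriv sm1 open_I) auto
  have cont: "continuous_on I f" if "smooth_on I f" for f :: "real \<Rightarrow> real"
    using that unfolding smooth_on_def by (metis times_differentiable_on.simps(1))
  have "\<kappa> t \<noteq> 0" if "t \<in> I" for t
    using nonzero[OF that] by (simp add: \<kappa>_def)
  then obtain e2 where e2: "e2 \<in> {1, -1}" "\<And>t. t \<in> I \<Longrightarrow> e2 * \<kappa> t > 0"
    using constant_sign_on_interval[OF int_I cont[OF smooth_\<kappa>]] by blast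
  obtain e1 where e1: "e1 \<in> {1, -1}" "\<And>t. t \<in> I \<Longrightarrow> e1 * \<gamma>1 t > 0"
    using constant_sign_on_interval[OF int_I cont[OF sm1] nonzero(1)] by blast
  define r where "r t = (e2 * \<kappa> t) powr (1 / real ?k)" for t
  have r_pos: "r t > 0" if "t \<in> I" for t
    unfolding r_def powr_gt_zero using e2(2)[OF that] by (metis less_irrefl)
  have r_power: "r t ^ ?k = e2 * \<kappa> t" if "t \<in> I" for t
  proof -
    have "r t ^ ?k = r t powr real ?k"
      using r_pos[OF that] by (rule powr_realpow[symmetric])
    also have "\<dots> = (e2 * \<kappa> t) powr (1 / real ?k * real ?k)"
      unfolding r_def by (rule powr_powr)
    also have "\<dots> = e2 * \<kappa> t"
      using e2(2)[OF that] by simp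
    finally show ?thesis .
  qed
  have \<kappa>: "\<kappa> t * (g' t ^ 3 * \<gamma>1 t ^ CARD('m)) = \<delta> t" if "t \<in> I" for t
    using nonzero[OF that] by (simp add: \<kappa>_def)
  have eq: "(e1 * r t) ^ ?k * g' t ^ 3 * \<gamma>1 t ^ CARD('m) = (e1 ^ ?k * e2) * \<delta> t" if "t \<in> I" for t
    unfolding power_mult_distrib r_power[OF that] by (subst \<kappa>[OF that, symmetric]) (simp only: mult_ac)
  \<comment> \<open>This is the sign in the power equation; \<open>e1\<close> drops out of it when n
    + 2 is even.\<close>
  have \<sigma>: "e1 ^ ?k * e2 \<in> {1, -1}"
    using e1(1) e2(1) by (cases "even ?k") auto
  have "curve_normal I U \<gamma>1 \<gamma>2 (\<lambda>t. e1 * r t)"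
  proof
    show "smooth_on I (\<lambda>t. e1 * r t)"
      unfolding r_def using e2(2)
      by (intro smooth_on_mult smooth_on_powr smooth_on_const smooth_\<kappa> open_I)
    show "\<gamma>1 t * (e1 * r t) > 0" if "t \<in> I" for t
      using mult_pos_pos[OF e1(2)[OF that] r_pos[OF that]] by (simp only: mult_ac)
    show "\<bar>e1 * r t\<bar> ^ (CARD('m) + 3) * \<bar>g' t\<bar> ^ 3 * \<bar>\<gamma>1 t\<bar> ^ CARD('m) = \<bar>\<delta> t\<bar>" if "t \<in> I" for t
    proof -
      have "\<bar>e1 * r t\<bar> ^ ?k * \<bar>g' t\<bar> ^ 3 * \<bar>\<gamma>1 t\<bar> ^ CARD('m) = \<bar>(e1 ^ ?k * e2) * \<delta> t\<bar>"
        unfolding eq[OF that, symmetric] by (simp only: abs_mult power_abs)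
      also have "\<dots> = \<bar>e1 ^ ?k * e2\<bar> * \<bar>\<delta> t\<bar>"
        by (rule abs_mult)
      also have "\<bar>e1 ^ ?k * e2\<bar> = 1"
        using \<sigma> by auto
      finally show ?thesis
        by simp
    qed
  qed
  then show ?thesis
    using that \<sigma> eq by blast
qed

end

context curve_normal
begin

text \<open>The power equation fixes the absolute value of \<open>\<mu>'\<close>. Continuity without
  zeros on an interval turns the pointwise sign into a global e, and the derivative equation passes
  the same e on to \<open>\<nu>'\<close>. Prescribing \<open>\<sigma>\<close> need not determine e:
  if n + 2 is even, passing to the negative of a solution keeps \<open>\<sigma>\<close>, and if it
  is odd, \<open>\<sigma>\<close> changes.\<close>

lemma normal_equations_unique:
  assumes eqs: "normal_equations n I \<gamma>1 \<gamma>2 \<sigma> \<mu>' \<nu>'" and \<sigma>: "\<sigma> \<in> {1, -1}" and n: "n = CARD('m) + 1"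
  shows "(\<forall>t\<in>I. \<mu>' t = \<mu> t \<and> \<nu>' t = \<nu> t) \<or> (\<forall>t\<in>I. \<mu>' t = - \<mu> t \<and> \<nu>' t = - \<nu> t)"
proof -
  have d: "\<mu>' differentiable_on I"
    and ode: "\<And>t. t \<in> I \<Longrightarrow> deriv \<mu>' t = - \<nu>' t * (\<delta> t / g' t)"
    and pow: "\<And>t. t \<in> I \<Longrightarrow> \<mu>' t ^ (CARD('m) + 3) * g' t ^ 3 * \<gamma>1 t ^ CARD('m) = \<sigma> * \<delta> t"
    using eqs n by (auto simp: normal_equations_def numeral_3_eq_3)
  have abs_eq: "\<bar>\<mu>' t\<bar> = \<bar>\<mu> t\<bar>" if t: "t \<in> I" for t
  proof -
    have "\<bar>\<mu>' t\<bar> ^ (CARD('m) + 3) * \<bar>g' t\<bar> ^ 3 * \<bar>\<gamma>1 t\<bar> ^ CARD('m) = \<bar>\<delta> t\<bar>"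
      using arg_cong[OF pow[OF t], of abs] \<sigma> by (auto simp: abs_mult power_abs)
    then have "\<bar>\<mu>' t\<bar> ^ (CARD('m) + 3) = \<bar>\<mu> t\<bar> ^ (CARD('m) + 3)"
      unfolding \<mu>_power[OF t, symmetric] using nonzero[OF t] by simp
    then show ?thesis
      by (subst (asm) power_eq_iff_eq_base) auto
  qed
  have "continuous_on I (\<lambda>t. \<mu>' t * \<mu> t)"
  proof (intro continuous_on_mult)
    show "continuous_on I \<mu>'"
      using d by (rule differentiable_imp_continuous_on)
    show "continuous_on I \<mu>"
      using smooth_\<mu> unfolding smooth_on_def by (metis times_differentiable_on.simps(1))
  qed
  moreover have "\<mu>' t * \<mu> t \<noteq> 0" if "t \<in> I" for t
    using \<mu>_nonzero[OF that] abs_eq[OF that] by auto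
  ultimately obtain e where e: "e \<in> {1, -1}" "\<And>t. t \<in> I \<Longrightarrow> e * (\<mu>' t * \<mu> t) > 0"
    using constant_sign_on_interval[OF int_I, of "\<lambda>t. \<mu>' t * \<mu> t"] by blast
  have \<mu>': "\<mu>' t = e * \<mu> t" if "t \<in> I" for t
    using abs_eq[OF that] e(1) e(2)[OF that] by (auto simp: abs_if zero_less_mult_iff mult_less_0_iff split: if_splits)
  have "\<nu>' t = e * \<nu> t" if t: "t \<in> I" for t
  proof -
    have "((\<lambda>t. e * \<mu> t) has_real_derivative e * deriv \<mu> t) (at t)"
      by (intro DERIV_cmult smooth_on_real_has_derivative[OF smooth_\<mu> t])
    then have "(\<mu>' has_real_derivative e * deriv \<mu> t) (at t)"
      by (rule has_field_derivative_transform_within_open[OF _ open_I t]) (simp add: \<mu>')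
    then have "deriv \<mu>' t = e * deriv \<mu> t"
      by (rule DERIV_imp_deriv)
    then have "\<nu>' t * (\<delta> t / g' t) = (e * \<nu> t) * (\<delta> t / g' t)"
      unfolding ode[OF t] \<nu>_equation[OF t] by simp
    moreover have "\<delta> t / g' t \<noteq> 0"
      using nonzero[OF t] by simp
    ultimately show ?thesis
      using mult_right_cancel by blast
  qed
  then show ?thesis
    using \<mu>' e(1) by auto
qed

end

theorem theorem3p3:
  fixes n :: nat
    and I :: "real set"
    and U :: "(real ^ 'm::finite) set"
    and \<gamma>1 \<gamma>2 :: "real \<Rightarrow> real"
    and F :: "real \<times> (real ^ 'm) \<Rightarrow> real ^ 'm option option"
  assumes "n \<ge> 3" and "CARD('m) = n - 1"
    and "open I" and "is_interval I" and "open U"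
    and "smooth_on I \<gamma>1" and "smooth_on I \<gamma>2"
    and "\<And>t. t \<in> I \<Longrightarrow>
           deriv \<gamma>1 t * \<gamma>1 t *
             (deriv (deriv \<gamma>2) t * deriv \<gamma>1 t - deriv (deriv \<gamma>1) t * deriv \<gamma>2 t) > 0"
    and F: "F = curve_hypersurface \<gamma>1 \<gamma>2"
  shows "convex_hypersurface (I \<times> U) F \<and>
    pointwise_SO_symmetry (I \<times> U) F \<and>
    (\<exists>\<mu> \<nu>. smooth_on I \<mu> \<and> smooth_on I \<nu> \<and>
       (\<forall>\<xi>. convex_affine_normal (I \<times> U) F \<xi> \<longleftrightarrow>
          (\<forall>t\<in>I. \<forall>u\<in>U.
             \<xi> (t, u) = \<mu> t *\<^sub>R e_n + \<nu> t *\<^sub>R vector_derivative (\<lambda>s. F (s, u)) (at t))) \<and>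
       (\<exists>\<sigma>\<in>{1, -1}. normal_equations n I \<gamma>1 \<gamma>2 \<sigma> \<mu> \<nu>) \<and>
       (\<forall>\<sigma>\<in>{1, -1}. \<forall>\<mu>' \<nu>'. normal_equations n I \<gamma>1 \<gamma>2 \<sigma> \<mu>' \<nu>' \<longrightarrow>
          (\<forall>t\<in>I. \<mu>' t = \<mu> t \<and> \<nu>' t = \<nu> t) \<or>
          (\<forall>t\<in>I. \<mu>' t = - \<mu> t \<and> \<nu>' t = - \<nu> t)))"
proof -
  have n: "n = CARD('m) + 1"
    using assms(1,2) by simp
  interpret curve_data I U \<gamma>1 \<gamma>2
    using assms by unfold_locales (auto simp: curve_det_def)
  obtain \<mu> \<sigma> where N: "curve_normal I U \<gamma>1 \<gamma>2 \<mu>" and \<sigma>: "\<sigma> \<in> {1, -1}"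
    and pow: "\<And>t. t \<in> I \<Longrightarrow> \<mu> t ^ (CARD('m) + 3) * deriv \<gamma>1 t ^ 3 * \<gamma>1 t ^ CARD('m) = \<sigma> * curve_det \<gamma>1 \<gamma>2 t"
    using exists_normal_scale by metis
  interpret curve_normal I U \<gamma>1 \<gamma>2 \<mu>
    by (rule N)
  have "convex_affine_normal (I \<times> U) F \<xi> \<longleftrightarrow> (\<forall>t\<in>I. \<forall>u\<in>U.
      \<xi> (t, u) = \<mu> t *\<^sub>R e_n + \<nu> t *\<^sub>R vector_derivative (\<lambda>s. F (s, u)) (at t))" for \<xi>
    unfolding F convex_affine_normal_unique by (auto simp: normal_def vector_derivative_F)
  moreover have "normal_equations n I \<gamma>1 \<gamma>2 \<sigma> \<mu> \<nu>"
    unfolding normal_equations_def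
  proof (intro conjI ballI)
    show "\<mu> differentiable_on I"
      using smooth_on_has_derivative[OF smooth_\<mu>] differentiable_def differentiable_at_withinI
      unfolding differentiable_on_def by blast
    show "deriv \<mu> t = - \<nu> t * (curve_det \<gamma>1 \<gamma>2 t / deriv \<gamma>1 t)" if "t \<in> I" for t
      using \<nu>_equation[OF that] .
    show "\<mu> t ^ (n + 2) * deriv \<gamma>1 t ^ 3 * \<gamma>1 t ^ (n - 1) = \<sigma> * curve_det \<gamma>1 \<gamma>2 t" if "t \<in> I" for t
      using pow[OF that] by (simp add: n numeral_3_eq_3)
  qed
  ultimately show ?thesis
    using convex symmetry smooth_\<mu> smooth_\<nu> \<sigma> normal_equations_unique[OF _ _ n] unfolding F by blast
qed

end
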